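(* Let $G$ be an acyclic network over $\mathbb F_q$ in which link failure pattern $f\in\mathcal F'$ occurs with probability $p_f$. Then the average min-cut between two distinct nodes $S$ and $T$ in $G$, denoted $mincut_{\mathcal F'}(S,T)$, is $$mincut_{\mathcal F'}(S,T)=\sum_{f\in\mathcal F'}p_f\left(\max_{\alpha_{(i,e)},\,\beta_{(e',e)},\,\epsilon_{(e',i)}}\operatorname{rank}(M_f)\right),$$ where $M_f$ is the system matrix from $S$ to $T$ of the network $G_f$, and each maximum is over all choices of the coefficients in $\mathbb F_q$ (and over the numbers $\mu(S)\le|O(S)|$ of source processes and $\nu(T)$ of destination processes).
   Context: Network. $G=(\mathcal V,\mathcal E)$ consists of a finite set $\mathcal V$ of nodes; each node $V$ has a finite set $I(V)$ of input ports and a finite set $O(V)$ of output ports (all pairwise disjoint). Each edge in $\mathcal E$ is an ordered pair $(e_1,e_2)$ with $e_1\in O(V_1)$ and $e_2\in I(V_2)$ for some $V_1,V_2\in\mathcal V$. $G$ is acyclic if the directed graph on $\mathcal V$ with an arc $V_1\to V_2$ whenever some edge goes from $O(V_1)$ to $I(V_2)$ has no directed cycle. Let $e_1,e_2,\dots$ enumerate all ports; $\mathbb F_q$ is a finite field. Failures. A link failure pattern $f$ is a set of failing edges; $G_f$ is the network obtained from $G$ by deleting the edges in $f$. $\mathcal F'$ is a finite set of failure patterns with probabilities $p_f\ge0$, $\sum_{f\in\mathcal F'}p_f=1$. Min-cut. For a network $H$ on node set $\mathcal V$, the min-cut between $S$ and $T$ in $H$ is $\min_\Omega\operatorname{rank}(H_\Omega)$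 over all $\Omega\subseteq\mathcal V$ with $S\in\Omega$, $T\notin\Omega$, where $H_\Omega$ is the $0$-$1$ matrix over $\mathbb F_q$ with rows the output ports of nodes in $\Omega$, columns the input ports of nodes in $\Omega^c$, and entry $1$ exactly when $H$ has an edge from the row port to the column port. The average min-cut $mincut_{\mathcal F'}(S,T)$ is the (time-)average, i.e. the expected value when $f$ occurs with probability $p_f$, of the min-cut between $S$ and $T$ in $G_f$. System matrix of a network $H$ with edge set $\mathcal E_H$. $F$ is the square matrix indexed by the ports with $F_{i,j}=1$ if $(e_i,e_j)\in\mathcal E_H$; $F_{i,j}=\beta_{(e_i,e_j)}$ if $e_i\in I(V)$ and $e_j\in O(V)$ for some node $V$; and $0$ otherwise. $A$ is $\mu(S)\times(\text{number of ports})$ with $A_{i,j}=\alpha_{(i,e_j)}$ if $e_j\in O(S)$ and $0$ otherwise. $B$ is $\nu(T)\times(\text{number of ports})$ with entry in row $k$, column $e_i$ equal to $\epsilon_{(e_i,(T,k))}$ if $e_i\in I(T)$ and $0$ otherwise. The system matrix is $A(I-F)^{-1}B^T$; $M_f$ is this matrix for $H=G_f$. *)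

theory Defs
  imports
    "HOL-Analysis.Bochner_Integration"
    "Jordan_Normal_Form.DL_Rank"
    "Jordan_Normal_Form.Gauss_Jordan_Elimination"
begin

(* The list ports is the enumeration e_1, e_2, ... of all ports (0-based, as matrix indices are). *)
record ('v, 'p) network =
  nodes :: "'v set"
  inp :: "'v \<Rightarrow> 'p set"
  outp :: "'v \<Rightarrow> 'p set"
  edges :: "('p \<times> 'p) set"
  ports :: "'p list"

definition wf_network :: "('v, 'p) network \<Rightarrow> bool" where
  "wf_network G \<longleftrightarrow>
     finite (nodes G) \<and>
     (\<forall>V\<in>nodes G. finite (inp G V) \<and> finite (outp G V)) \<and>
     (\<forall>V\<in>nodes G. \<forall>W\<in>nodes G. inp G V \<inter> outp G W = {}) \<and>
     (\<forall>V\<in>nodes G. \<forall>W\<in>nodes G. V \<noteq> W \<longrightarrow> inp G V \<inter> inp G W = {} \<and> outp G V \<inter> outp G W = {}) \<and>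
     edges G \<subseteq> (\<Union>V\<in>nodes G. outp G V) \<times> (\<Union>V\<in>nodes G. inp G V) \<and>
     distinct (ports G) \<and>
     set (ports G) = (\<Union>V\<in>nodes G. inp G V \<union> outp G V)"

definition arcs :: "('v, 'p) network \<Rightarrow> ('v \<times> 'v) set" where
  "arcs G = {(V, W). V \<in> nodes G \<and> W \<in> nodes G \<and> (\<exists>e\<in>outp G V. \<exists>e'\<in>inp G W. (e, e') \<in> edges G)}"

definition acyclic_network :: "('v, 'p) network \<Rightarrow> bool" where
  "acyclic_network G \<longleftrightarrow> acyclic (arcs G)"

definition delete_edges :: "('v, 'p) network \<Rightarrow> ('p \<times> 'p) set \<Rightarrow> ('v, 'p) network" where
  "delete_edges G f = G\<lparr>edges := edges G - f\<rparr>"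

(* vec_space.rank takes the dimension of the column vectors as a separate argument. *)
abbreviation mat_rank :: "'k::field mat \<Rightarrow> nat" where
  "mat_rank M \<equiv> vec_space.rank (dim_row M) M"

(* Rows and columns are taken in the order of the port enumeration. *)
definition cut_matrix :: "('v, 'p) network \<Rightarrow> 'v set \<Rightarrow> 'k::field mat" where
  "cut_matrix H \<Omega> =
     (let rs = filter (\<lambda>e. \<exists>V\<in>\<Omega>. e \<in> outp H V) (ports H);
          cs = filter (\<lambda>e. \<exists>V\<in>nodes H - \<Omega>. e \<in> inp H V) (ports H)
      in mat (length rs) (length cs) (\<lambda>(i, j). if (rs ! i, cs ! j) \<in> edges H then 1 else 0))"

definition mincut :: "'k::field itself \<Rightarrow> ('v, 'p) network \<Rightarrow> 'v \<Rightarrow> 'v \<Rightarrow> nat" where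
  "mincut _ H S T =
     Min {mat_rank (cut_matrix H \<Omega> :: 'k mat) | \<Omega>. \<Omega> \<subseteq> nodes H \<and> S \<in> \<Omega> \<and> T \<notin> \<Omega>}"

(* Expected value when the pattern f is drawn from Fs with probability p f. *)
definition average_mincut ::
  "'k::field itself \<Rightarrow> ('v, 'p) network \<Rightarrow> ('p \<times> 'p) set set \<Rightarrow> (('p \<times> 'p) set \<Rightarrow> real)
     \<Rightarrow> 'v \<Rightarrow> 'v \<Rightarrow> real" where
  "average_mincut K G Fs p S T =
     (LINT f|point_measure Fs (\<lambda>f. ennreal (p f)). real (mincut K (delete_edges G f) S T))"

definition F_matrix :: "('v, 'p) network \<Rightarrow> ('p \<times> 'p \<Rightarrow> 'k::field) \<Rightarrow> 'k mat" where
  "F_matrix H \<beta> = mat (length (ports H)) (length (ports H)) (\<lambda>(i, j).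
     if (ports H ! i, ports H ! j) \<in> edges H then 1
     else if \<exists>V\<in>nodes H. ports H ! i \<in> inp H V \<and> ports H ! j \<in> outp H V
       then \<beta> (ports H ! i, ports H ! j)
     else 0)"

definition A_matrix :: "('v, 'p) network \<Rightarrow> 'v \<Rightarrow> nat \<Rightarrow> (nat \<times> 'p \<Rightarrow> 'k::field) \<Rightarrow> 'k mat" where
  "A_matrix H S \<mu> \<alpha> = mat \<mu> (length (ports H)) (\<lambda>(i, j).
     if ports H ! j \<in> outp H S then \<alpha> (i, ports H ! j) else 0)"

definition B_matrix ::
  "('v, 'p) network \<Rightarrow> 'v \<Rightarrow> nat \<Rightarrow> ('p \<times> 'v \<times> nat \<Rightarrow> 'k::field) \<Rightarrow> 'k mat" where
  "B_matrix H T \<nu> \<epsilon> = mat \<nu> (length (ports H)) (\<lambda>(k, i).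
     if ports H ! i \<in> inp H T then \<epsilon> (ports H ! i, T, k) else 0)"

(* mat_inverse is option-valued; for acyclic networks I - F is invertible, see below. *)
definition system_matrix ::
  "('v, 'p) network \<Rightarrow> 'v \<Rightarrow> 'v \<Rightarrow> nat \<Rightarrow> nat \<Rightarrow> (nat \<times> 'p \<Rightarrow> 'k::field)
     \<Rightarrow> ('p \<times> 'p \<Rightarrow> 'k) \<Rightarrow> ('p \<times> 'v \<times> nat \<Rightarrow> 'k) \<Rightarrow> 'k mat" where
  "system_matrix H S T \<mu> \<nu> \<alpha> \<beta> \<epsilon> =
     A_matrix H S \<mu> \<alpha>
     * the (mat_inverse (1\<^sub>m (length (ports H)) - F_matrix H \<beta>))
     * transpose_mat (B_matrix H T \<nu> \<epsilon>)"

lemma I_minus_F_kernel: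
  fixes \<beta> :: "'p \<times> 'p \<Rightarrow> 'k::field"
  assumes wf: "wf_network H" and ac: "acyclic_network H"
    and v: "\<And>i. i < length (ports H) \<Longrightarrow>
      v i = (\<Sum>j<length (ports H). F_matrix H \<beta> $$ (i, j) * v j)"
    and V: "V \<in> nodes H"
  shows "\<forall>i<length (ports H). ports H ! i \<in> inp H V \<union> outp H V \<longrightarrow> v i = 0"
proof -
  let ?n = "length (ports H)"
  have "arcs H \<subseteq> nodes H \<times> nodes H" by (auto simp: arcs_def)
  then have "finite (arcs H)"
    using wf by (meson finite_SigmaI finite_subset wf_network_def)
  then have "wf ((arcs H)\<inverse>)"
    using ac by (simp add: acyclic_network_def finite_acyclic_wf_converse)
  then show ?thesis using V
  proof (induction V rule: wf_induct_rule)
    case (less V)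
    have wfs: "\<forall>V\<in>nodes H. \<forall>W\<in>nodes H. inp H V \<inter> outp H W = {}"
      "\<forall>V\<in>nodes H. \<forall>W\<in>nodes H. V \<noteq> W \<longrightarrow> inp H V \<inter> inp H W = {} \<and> outp H V \<inter> outp H W = {}"
      "edges H \<subseteq> (\<Union>V\<in>nodes H. outp H V) \<times> (\<Union>V\<in>nodes H. inp H V)"
      using wf unfolding wf_network_def by simp_all
    have disj: "\<And>W e. W \<in> nodes H \<Longrightarrow> e \<in> outp H V \<Longrightarrow> e \<notin> inp H W"
      "\<And>W e. W \<in> nodes H \<Longrightarrow> e \<in> inp H V \<Longrightarrow> e \<notin> outp H W"
      "\<And>W e. W \<in> nodes H \<Longrightarrow> e \<in> inp H V \<Longrightarrow> e \<in> inp H W \<Longrightarrow> W = V"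
      using wfs(1,2) less.prems by (metis disjoint_iff)+
    have E: "\<And>e e'. (e, e') \<in> edges H \<Longrightarrow>
        (\<exists>W\<in>nodes H. e \<in> outp H W) \<and> (\<exists>W\<in>nodes H. e' \<in> inp H W)"
      using wfs(3) by auto
    have out: "v i = 0" if i: "i < ?n" "ports H ! i \<in> outp H V" for i
    proof -
      have "F_matrix H \<beta> $$ (i, j) * v j = 0" if j: "j < ?n" for j
      proof (cases "(ports H ! i, ports H ! j) \<in> edges H")
        case True
        then obtain W where W: "W \<in> nodes H" "ports H ! j \<in> inp H W" using E by blast
        then have "(W, V) \<in> (arcs H)\<inverse>" using i True less.prems by (auto simp: arcs_def)
        then have "v j = 0" using less.IH W j by blast
        then show ?thesis by simp
      next
        case False
        then have "F_matrix H \<beta> $$ (i, j) = 0"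
          using i j disj(1) by (auto simp: F_matrix_def)
        then show ?thesis by simp
      qed
      then have "(\<Sum>j<?n. F_matrix H \<beta> $$ (i, j) * v j) = 0" by (intro sum.neutral) simp
      then show ?thesis using v[OF i(1)] by simp
    qed
    have "v i = 0" if i: "i < ?n" "ports H ! i \<in> inp H V" for i
    proof -
      have "F_matrix H \<beta> $$ (i, j) * v j = 0" if j: "j < ?n" for j
      proof (cases "ports H ! j \<in> outp H V")
        case True
        then show ?thesis using out j by simp
      next
        case False
        moreover have "(ports H ! i, ports H ! j) \<notin> edges H" using E disj(2) i by blast
        ultimately have "F_matrix H \<beta> $$ (i, j) = 0"
          using i j disj(3) by (auto simp: F_matrix_def)
        then show ?thesis by simp
      qed
      then have "(\<Sum>j<?n. F_matrix H \<beta> $$ (i, j) * v j) = 0" by (intro sum.neutral) simp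
      then show ?thesis using v[OF i(1)] by simp
    qed
    then show ?case using out by blast
  qed
qed

lemma mat_inverse_I_minus_F:
  fixes \<beta> :: "'p \<times> 'p \<Rightarrow> 'k::field"
  assumes wf: "wf_network H" and ac: "acyclic_network H"
  shows "\<exists>X. mat_inverse (1\<^sub>m (length (ports H)) - F_matrix H \<beta>) = Some X"
proof -
  let ?n = "length (ports H)" and ?F = "F_matrix H \<beta>"
  have F: "?F \<in> carrier_mat ?n ?n" by (simp add: F_matrix_def)
  then have M: "1\<^sub>m ?n - ?F \<in> carrier_mat ?n ?n" by (intro minus_carrier_mat)
  have "det (1\<^sub>m ?n - ?F) \<noteq> 0"
  proof
    assume "det (1\<^sub>m ?n - ?F) = 0"
    then obtain v where v: "v \<in> carrier_vec ?n" "v \<noteq> 0\<^sub>v ?n" "(1\<^sub>m ?n - ?F) *\<^sub>v v = 0\<^sub>v ?n"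
      using det_0_iff_vec_prod_zero_field[OF M] by blast
    have "v = ?F *\<^sub>v v"
    proof -
      have "(1\<^sub>m ?n - ?F) *\<^sub>v v = v - ?F *\<^sub>v v"
        using F v(1) minus_mult_distrib_mat_vec[of "1\<^sub>m ?n" ?n ?n ?F v] by simp
      then have z: "v - ?F *\<^sub>v v = 0\<^sub>v ?n" using v(3) by simp
      show ?thesis
      proof (rule eq_vecI)
        fix i assume "i < dim_vec (?F *\<^sub>v v)"
        then have i: "i < ?n" using F by simp
        have "vec_index (v - ?F *\<^sub>v v) i = 0" using z i by simp
        then show "vec_index v i = vec_index (?F *\<^sub>v v) i" using i F v(1) by simp
      qed (use F v(1) in auto)
    qed
    then have eq: "vec_index v i = (\<Sum>j<?n. ?F $$ (i, j) * vec_index v j)" if "i < ?n" for i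
    proof -
      have "vec_index (?F *\<^sub>v v) i = (\<Sum>j<?n. ?F $$ (i, j) * vec_index v j)"
        using that F v(1) by (auto simp: scalar_prod_def atLeast0LessThan intro!: sum.cong)
      then show ?thesis using \<open>v = ?F *\<^sub>v v\<close> by simp
    qed
    have "vec_index v i = 0" if i: "i < ?n" for i
    proof -
      have "ports H ! i \<in> (\<Union>V\<in>nodes H. inp H V \<union> outp H V)"
        using i wf unfolding wf_network_def by (metis nth_mem)
      then obtain V where "V \<in> nodes H" "ports H ! i \<in> inp H V \<union> outp H V" by blast
      then show ?thesis using I_minus_F_kernel[OF wf ac eq] i by blast
    qed
    then have "v = 0\<^sub>v ?n" using v(1) by auto
    then show False using v(2) by simp
  qed
  then have "1\<^sub>m ?n - ?F \<in> Units (ring_mat TYPE('k) ?n ())"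
    by (rule det_non_zero_imp_unit[OF M])
  then show ?thesis using mat_inverse(1)[OF M, where b = "()"] by (cases "mat_inverse (1\<^sub>m ?n - ?F)") auto
qed

end

(*
  Upper bound: let a vector c select a combination of the columns of M. The backward signals it
  induces on the Omega side of a cut are determined, through an acyclic system, by what the cut matrix
  passes on from the other side. If that is zero, they vanish and M c = 0; so M has at most the rank
  of the cut matrix.

  Lower bound: for signals u on the output ports outside T, let N_i be the column of the adjacency
  matrix belonging to the input port i and e_x the unit vector of the output port x. A relay coefficient
  vector for an output x of V makes u orthogonal to e_x - sum_i beta_(i,x) N_i (i in I(V)); a received
  zero at an input i of T makes u orthogonal to N_i; a source port left unused makes u orthogonal to
  e_x. Choosing one such vector for each of |O - O(T)| slots so that all are linearly independent
  forces u = 0, that is, a system matrix of full rank r. Such a choice is an independent transversal,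
  and by Rado's theorem it exists because every cut has rank at least r. The relay coefficients are
  0 or 1, so the size of the field plays no role.
*)
theory Submission
  imports Defs "HOL-Library.Function_Algebras"
begin

unbundle no vec_syntax

section \<open>Rado's theorem for vectors\<close>

context vector_space
begin

text \<open>The field is fixed and may have only two elements, so the coefficients cannot be found
  as a point where a determinant polynomial does not vanish. Path packings do not settle the matter
  either: an output may feed several inputs and an input adds up several outputs, so a cut is
  measured by the rank of a matrix and not by a number of edges. Rado's theorem meets both points,
  since it picks actual members of finite sets of vectors and asks only about dimensions. The set
  for a relay port x contains e_x besides the vectors e_x - N_i. This puts N_i into its span, so
  that a set of slots spans the columns of the cut that places the nodes owning its relay ports on
  the side of T.\<close>

lemma card_independent_le_dim:
  assumes "finite X" and "B \<subseteq> span X" and "independent B"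
  shows "finite B \<and> card B \<le> dim X"
proof -
  obtain C where C: "C \<subseteq> X" "independent C" "X \<subseteq> span C" "card C = dim X"
    using basis_exists by blast
  moreover have "B \<subseteq> span C"
    using assms(2) C(3) span_minimal[OF C(3) subspace_span] by blast
  ultimately show ?thesis
    using independent_span_bound[OF finite_subset[OF C(1) assms(1)] assms(3)] by simp
qed

text \<open>Finiteness of \<open>Y\<close> matters: a set with an infinite basis has
  \<open>dim\<close> 0, because \<open>card\<close> of an infinite set is 0.\<close>

lemma dim_finite_mono:
  assumes "finite Y" and "X \<subseteq> Y"
  shows "dim X \<le> dim Y"
proof -
  obtain C where "C \<subseteq> X" "independent C" "card C = dim X"
    using basis_exists by metis
  then show ?thesis
    using card_independent_le_dim[OF assms(1)] assms(2) span_superset by (metis subset_trans)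
qed

text \<open>A basis B of the intersection extends to bases C of \<open>X\<close> and D of
  \<open>Y\<close>; C \<union> D spans the union, while C \<inter> D still contains B. This
  submodularity drives the exchange argument in Rado's theorem.\<close>

lemma dim_Un_Int_le:
  assumes "finite X" and "finite Y"
  shows "dim (X \<union> Y) + dim (X \<inter> Y) \<le> dim X + dim Y"
proof -
  obtain B where B: "B \<subseteq> X \<inter> Y" "independent B" "card B = dim (X \<inter> Y)"
    using basis_exists by metis
  obtain C where C: "B \<subseteq> C" "C \<subseteq> X" "independent C" "X \<subseteq> span C"
    using maximal_independent_subset_extend[of B X] B by auto
  obtain D where D: "B \<subseteq> D" "D \<subseteq> Y" "independent D" "Y \<subseteq> span D"
    using maximal_independent_subset_extend[of B Y] B by auto
  have fin: "finite C" "finite D"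
    using C(2) D(2) assms finite_subset by blast+
  have "X \<union> Y \<subseteq> span (C \<union> D)"
    using C(4) D(4) span_mono[of C "C \<union> D"] span_mono[of D "C \<union> D"] by blast
  then have "dim (X \<union> Y) \<le> card (C \<union> D)"
    using dim_le_card fin by blast
  moreover have "card B \<le> card (C \<inter> D)"
    using B C(1) D(1) fin by (intro card_mono) auto
  moreover have "card (C \<union> D) + card (C \<inter> D) = card C + card D"
    using card_Un_Int[OF fin] by simp
  moreover have "card C = dim X" "card D = dim Y"
    using basis_card_eq_dim C D by auto
  ultimately show ?thesis using B(3) by linarith
qed

text \<open>The sets are thinned out one element at a time while the dimension condition is kept,
  hence the induction on their total size. If a set has two elements and neither can be removed, the
  two violated conditions contradict submodularity of \<open>dim\<close>.\<close>

theorem rado_transversal: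
  assumes "finite J" and "\<And>j. j \<in> J \<Longrightarrow> finite (A j)"
    and "\<And>K. K \<subseteq> J \<Longrightarrow> card K \<le> dim (\<Union>j\<in>K. A j)"
  shows "\<exists>x. (\<forall>j\<in>J. x j \<in> A j) \<and> inj_on x J \<and> independent (x ` J)"
  using assms(2,3)
proof (induction "\<Sum>j\<in>J. card (A j)" arbitrary: A rule: less_induct)
  case less
  note finA = less.prems(1) and rado = less.prems(2)
  have finU: "finite (\<Union>j\<in>K. A j)" if "K \<subseteq> J" for K
    using that finA assms(1) by (meson finite_UN finite_subset subsetD)
  have ne: "A j \<noteq> {}" if "j \<in> J" for j
  proof
    assume "A j = {}"
    moreover have "card {j} \<le> dim (\<Union>i\<in>{j}. A i)" using rado[of "{j}"] that by blast
    ultimately show False using dim_le_card[of "{}" "{}"] by simp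
  qed
  show ?case
  proof (cases "\<exists>j\<in>J. \<exists>a\<in>A j. \<exists>b\<in>A j. a \<noteq> b")
    case False
    \<comment> \<open>Every set is the singleton of \<open>x j\<close>. The condition for
      \<open>J\<close> itself then leaves no room for a repeated value or a linear relation.\<close>
    define x where "x j = (SOME a. a \<in> A j)" for j
    have x: "A j = {x j}" if "j \<in> J" for j
      using ne[OF that] False that unfolding x_def by (metis singletonI some_in_eq subsetI subset_antisym subset_singleton_iff)
    have le: "card J \<le> dim (x ` J)"
    proof -
      have "(\<Union>j\<in>J. A j) = x ` J" using x by auto
      then show ?thesis using rado[of J] by simp
    qed
    obtain C where C: "C \<subseteq> x ` J" "independent C" "card C = dim (x ` J)"
      using basis_exists by metis
    have "card (x ` J) \<le> card C" using le C(3) card_image_le[OF assms(1), of x] by linarith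
    then have "C = x ` J" using card_seteq[OF _ C(1)] assms(1) by blast
    moreover have "inj_on x J"
      using le C(3) card_image_le[OF assms(1), of x] \<open>C = x ` J\<close> assms(1)
      by (intro eq_card_imp_inj_on) auto
    ultimately show ?thesis using x C(2) by (intro exI[of _ x]) auto
  next
    case True
    then obtain j a b where j: "j \<in> J" and ab: "a \<in> A j" "b \<in> A j" "a \<noteq> b" by blast
    let ?del = "\<lambda>c. A(j := A j - {c})"
    have step: ?thesis
      if c: "c \<in> A j" and ok: "\<And>K. K \<subseteq> J \<Longrightarrow> card K \<le> dim (\<Union>i\<in>K. ?del c i)" for c
    proof -
      have "(\<Sum>i\<in>J. card (?del c i)) < (\<Sum>i\<in>J. card (A i))"
      proof (rule sum_strict_mono_ex1[OF assms(1)])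
        show "\<forall>i\<in>J. card (?del c i) \<le> card (A i)"
          using finA by (auto intro!: card_mono)
        show "\<exists>i\<in>J. card (?del c i) < card (A i)"
          using j c finA[OF j] card_Diff1_less[of "A j" c] by (intro bexI[of _ j]) simp_all
      qed
      then have "\<exists>x. (\<forall>i\<in>J. x i \<in> ?del c i) \<and> inj_on x J \<and> independent (x ` J)"
        using less.hyps[of "?del c"] finA ok by fastforce
      then obtain x where x: "\<forall>i\<in>J. x i \<in> ?del c i" "inj_on x J" "independent (x ` J)" by blast
      have "x i \<in> A i" if "i \<in> J" for i
        using x(1) that by (cases "i = j") auto
      then show ?thesis using x by blast
    qed
    \<comment> \<open>Only index sets containing \<open>j\<close> notice the removal. Taking
      \<open>j\<close> out of such a set turns the strict inequality into the non-strict one stated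
      here.\<close>
    have viol: "\<exists>K. K \<subseteq> J - {j} \<and> dim ((\<Union>i\<in>K. A i) \<union> (A j - {c})) \<le> card K"
      if bad: "\<not> (\<forall>K\<subseteq>J. card K \<le> dim (\<Union>i\<in>K. ?del c i))" for c
    proof -
      obtain K where K: "K \<subseteq> J" "dim (\<Union>i\<in>K. ?del c i) < card K"
        using bad by (meson not_le)
      have "j \<in> K"
      proof (rule ccontr)
        assume "j \<notin> K"
        then have "(\<Union>i\<in>K. ?del c i) = (\<Union>i\<in>K. A i)" by (intro SUP_cong) auto
        then show False using K rado[of K] by simp
      qed
      moreover have "(\<Union>i\<in>K. ?del c i) = (\<Union>i\<in>K - {j}. A i) \<union> (A j - {c})"
        using \<open>j \<in> K\<close> by (auto split: if_splits)
      moreover have "card (K - {j}) = card K - 1"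
        using \<open>j \<in> K\<close> by simp
      ultimately show ?thesis using K by (intro exI[of _ "K - {j}"]) auto
    qed
    show ?thesis
    proof (rule ccontr)
      assume no: "\<not> ?thesis"
      obtain K where K: "K \<subseteq> J - {j}" "dim ((\<Union>i\<in>K. A i) \<union> (A j - {a})) \<le> card K"
        using viol[of a] step[OF ab(1)] no by blast
      obtain L where L: "L \<subseteq> J - {j}" "dim ((\<Union>i\<in>L. A i) \<union> (A j - {b})) \<le> card L"
        using viol[of b] step[OF ab(2)] no by blast
      let ?X = "(\<Union>i\<in>K. A i) \<union> (A j - {a})" and ?Y = "(\<Union>i\<in>L. A i) \<union> (A j - {b})"
      have KL: "finite K" "finite L" "j \<notin> K" "j \<notin> L"
        using K(1) L(1) finite_subset[of K J] finite_subset[of L J] assms(1) by blast+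
      have fin: "finite ?X" "finite ?Y"
        using finU[of K] finU[of L] K(1) L(1) finA[OF j] by auto
      \<comment> \<open>As \<open>a\<close> and \<open>b\<close> differ, the union of
        \<open>?X\<close> and \<open>?Y\<close> recovers all of \<open>A j\<close>, while their
        intersection contains the sets indexed by \<open>K \<inter> L\<close>. The two lower bounds
        add up to card K + card L + 1, one more than submodularity permits.\<close>
      have "card (insert j (K \<union> L)) \<le> dim (\<Union>i\<in>insert j (K \<union> L). A i)"
        using K(1) L(1) j by (intro rado) auto
      also have "\<dots> \<le> dim (?X \<union> ?Y)"
        using fin ab by (intro dim_finite_mono) auto
      finally have "card (K \<union> L) + 1 \<le> dim (?X \<union> ?Y)"
        using KL by simp
      moreover have "card (K \<inter> L) \<le> dim (?X \<inter> ?Y)"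
      proof -
        have "card (K \<inter> L) \<le> dim (\<Union>i\<in>K \<inter> L. A i)"
          using K(1) by (intro rado) auto
        also have "\<dots> \<le> dim (?X \<inter> ?Y)"
          using fin by (intro dim_finite_mono) auto
        finally show ?thesis .
      qed
      moreover have "card K + card L = card (K \<union> L) + card (K \<inter> L)"
        using card_Un_Int KL by blast
      ultimately show False
        using dim_Un_Int_le[OF fin] K(2) L(2) by linarith
    qed
  qed
qed

end

section \<open>Rank of a matrix via independent columns\<close>

text \<open>Signals on ports and columns of matrices become functions with pointwise operations.
  They fill a whole type, so Rado's theorem applies to them without carrier sets.\<close>

global_interpretation fun_space: vector_space "\<lambda>(c::'k::field) (f::'a \<Rightarrow> 'k) x. c * f x"
  by unfold_locales (auto simp: fun_eq_iff algebra_simps)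

lemma sum_fun_eval: "(\<Sum>i\<in>I. f i) x = (\<Sum>i\<in>I. f i x)"
  by (induction I rule: infinite_finite_induct) auto

text \<open>A condition on the family of column indices: two equal columns count as dependent,
  whereas the set of column vectors would merge them.\<close>

definition independent_columns :: "'k::field mat \<Rightarrow> nat set \<Rightarrow> bool" where
  "independent_columns A C \<longleftrightarrow> C \<subseteq> {..<dim_col A} \<and>
     (\<forall>c. (\<forall>i<dim_row A. (\<Sum>j\<in>C. c j * A $$ (i, j)) = 0) \<longrightarrow> (\<forall>j\<in>C. c j = 0))"

text \<open>Translates the carrier-based rank into sums over indices. A maximal independent set of
  columns has \<open>mat_rank A\<close> members, and any \<open>r\<close> of them stay independent;
  conversely, independent columns are pairwise distinct, so their number is a lower bound.\<close>

lemma mat_rank_ge_iff: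
  "r \<le> mat_rank A \<longleftrightarrow> (\<exists>C. independent_columns A C \<and> card C = r)"
proof -
  interpret vec_space "TYPE('a)" "dim_row A" .
  have A: "A \<in> carrier_mat (dim_row A) (dim_col A)" by simp
  have idx: "lincomb a (col A ` C) $ i = (\<Sum>j\<in>C. a (col A j) * A $$ (i, j))"
    if C: "C \<subseteq> {..<dim_col A}" "inj_on (col A) C" and i: "i < dim_row A" for a C i
  proof -
    have "lincomb a (col A ` C) $ i = (\<Sum>x\<in>col A ` C. a x * x $ i)"
      using C(1) by (intro lincomb_index[OF i]) auto
    also have "\<dots> = (\<Sum>j\<in>C. a (col A j) * A $$ (i, j))"
      using C i by (subst sum.reindex) (auto intro!: sum.cong)
    finally show ?thesis .
  qed
  have sub: "finite (col A ` C)" "col A ` C \<subseteq> carrier V" if "C \<subseteq> {..<dim_col A}" for C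
    using that finite_subset by auto
  show ?thesis
  proof
    assume r: "r \<le> mat_rank A"
    obtain U where U: "maximal U (\<lambda>T. T \<subseteq> set (cols A) \<and> lin_indpt T)"
      using maximal_exists[of "(\<lambda>T. T \<subseteq> set (cols A) \<and> lin_indpt T)" "card (set (cols A))" "{}"]
      by (meson List.finite_set card_mono empty_iff empty_subsetI finite_lin_indpt2 rev_finite_subset)
    then have "mat_rank A = card U" and U': "U \<subseteq> set (cols A)" "lin_indpt U"
      using rank_card_indpt[OF A] unfolding maximal_def by auto
    then obtain W where W: "W \<subseteq> U" "card W = r" "finite W"
      using r obtain_subset_with_card_n by metis
    have "lin_indpt W" using W U' subset_li_is_li by blast
    have "W \<subseteq> col A ` {..<dim_col A}"
      using W(1) U'(1) by (auto simp: cols_def)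
    then obtain C where C: "C \<subseteq> {..<dim_col A}" "inj_on (col A) C" "W = col A ` C"
      by (meson subset_image_inj)
    have "independent_columns A C"
      unfolding independent_columns_def
    proof (intro conjI C(1) allI impI ballI)
      fix c j assume c: "\<forall>i<dim_row A. (\<Sum>j\<in>C. c j * A $$ (i, j)) = 0" and j: "j \<in> C"
      \<comment> \<open>Coefficients are given on column numbers, but \<open>lincomb\<close> takes
        them on vectors; the columns in \<open>C\<close> are distinct, so they can be
        transported.\<close>
      define a where "a = c \<circ> the_inv_into C (col A)"
      have a: "a (col A j) = c j" if "j \<in> C" for j
        using that C(2) by (simp add: a_def the_inv_into_f_f)
      have "lincomb a W = 0\<^sub>v (dim_row A)"
      proof (rule eq_vecI)
        show "dim_vec (lincomb a W) = dim_vec (0\<^sub>v (dim_row A))"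
          using lincomb_closed[of W a] sub(2)[OF C(1)] C(3) by auto
        fix i assume "i < dim_vec (0\<^sub>v (dim_row A))"
        then show "lincomb a W $ i = 0\<^sub>v (dim_row A) $ i"
          using idx[OF C(1,2)] c a C(3) by simp
      qed
      then have "a \<in> W \<rightarrow> {\<zero>\<^bsub>class_ring\<^esub>}"
        using not_lindepD[OF \<open>lin_indpt W\<close> W(3) subset_refl, of a] by (simp add: module_vec_simps)
      then have "a (col A j) = 0" using C(3) j by auto
      then show "c j = 0" using a j by simp
    qed
    moreover have "card C = r" using W(2) C(2,3) card_image by metis
    ultimately show "\<exists>C. independent_columns A C \<and> card C = r" by blast
  next
    assume "\<exists>C. independent_columns A C \<and> card C = r"
    then obtain C where C: "independent_columns A C" "card C = r" by blast
    then have CA: "C \<subseteq> {..<dim_col A}" and finC: "finite C"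
      and ind: "\<And>c j. \<forall>i<dim_row A. (\<Sum>j\<in>C. c j * A $$ (i, j)) = 0 \<Longrightarrow> j \<in> C \<Longrightarrow> c j = 0"
      unfolding independent_columns_def using finite_subset by auto
    have inj: "inj_on (col A) C"
    proof (rule inj_onI, rule ccontr)
      fix j k assume jk: "j \<in> C" "k \<in> C" "col A j = col A k" "j \<noteq> k"
      let ?c = "\<lambda>l. if l = j then 1 else if l = k then -1 else (0::'a)"
      have "(\<Sum>l\<in>C. ?c l * A $$ (i, l)) = 0" if i: "i < dim_row A" for i
      proof -
        have "(\<Sum>l\<in>C. ?c l * A $$ (i, l)) = (\<Sum>l\<in>{j, k}. ?c l * A $$ (i, l))"
          using jk finC by (intro sum.mono_neutral_right) auto
        also have "\<dots> = A $$ (i, j) - A $$ (i, k)" using jk(4) by simp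
        also have "A $$ (i, j) = col A j $ i" using jk(1) CA i by auto
        also have "\<dots> = A $$ (i, k)" unfolding jk(3) using jk(2) CA i by auto
        finally show ?thesis by simp
      qed
      then show False using ind[of ?c j] jk(1) by simp
    qed
    have "a v = 0" if a: "lincomb a (col A ` C) = 0\<^sub>v (dim_row A)" and v: "v \<in> col A ` C" for a v
    proof -
      have "(\<Sum>j\<in>C. a (col A j) * A $$ (i, j)) = 0" if "i < dim_row A" for i
        using idx[OF CA inj that, of a] that a by simp
      then have "a (col A j) = 0" if "j \<in> C" for j
        using ind[of "\<lambda>j. a (col A j)"] that by blast
      then show ?thesis using v by blast
    qed
    then have "lin_indpt (col A ` C)"
      using sub[OF CA] by (intro finite_lin_indpt2) (auto simp: module_vec_simps)
    moreover have "col A ` C \<subseteq> set (cols A)" using CA by (auto simp: cols_def)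
    ultimately have "card (col A ` C) \<le> rank A" using rank_ge_card_indpt[OF A] by blast
    then show "r \<le> mat_rank A" using C(2) card_image[OF inj] by simp
  qed
qed

text \<open>The extension by zero adds no condition, so linear relations among these functions are
  those among the columns.\<close>

definition column_fun :: "'k::field mat \<Rightarrow> nat \<Rightarrow> nat \<Rightarrow> 'k" where
  "column_fun A j = (\<lambda>i. if i < dim_row A then A $$ (i, j) else 0)"

text \<open>Independence of the image set does not notice repetitions, so the version for families
  splits into injectivity and independence of the image. The next lemma puts the two together
  again.\<close>

lemma fun_space_independent_family:
  fixes g :: "'i \<Rightarrow> 'a \<Rightarrow> 'k::field"
  assumes "finite C"
    and "\<And>c j. (\<And>x. (\<Sum>j\<in>C. c j * g j x) = 0) \<Longrightarrow> j \<in> C \<Longrightarrow> c j = 0"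
  shows "inj_on g C" and "fun_space.independent (g ` C)"
proof -
  show inj: "inj_on g C"
  proof (rule inj_onI, rule ccontr)
    fix j k assume jk: "j \<in> C" "k \<in> C" "g j = g k" "j \<noteq> k"
    let ?c = "\<lambda>l. if l = j then 1 else if l = k then -1 else (0::'k)"
    have zero: "(\<Sum>l\<in>C. ?c l * g l x) = 0" for x
    proof -
      have "(\<Sum>l\<in>C. ?c l * g l x) = (\<Sum>l\<in>{j, k}. ?c l * g l x)"
        using jk assms(1) by (intro sum.mono_neutral_right) auto
      also have "\<dots> = g j x - g k x" using jk(4) by simp
      also have "\<dots> = 0" unfolding jk(3) by simp
      finally show ?thesis .
    qed
    have "?c j = 0" by (rule assms(2)[OF zero jk(1)])
    then show False by simp
  qed
  show "fun_space.independent (g ` C)"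
  proof (rule fun_space.independent_if_scalars_zero)
    fix f v assume f: "(\<Sum>v\<in>g ` C. (\<lambda>x. f v * v x)) = 0" and v: "v \<in> g ` C"
    have zero: "(\<Sum>j\<in>C. f (g j) * g j x) = 0" for x
      using fun_cong[OF f, of x] by (simp add: sum_fun_eval sum.reindex[OF inj])
    have "f (g j) = 0" if "j \<in> C" for j
      by (rule assms(2)[OF zero that])
    then show "f v = 0" using v by blast
  qed (use assms(1) in simp)
qed

lemma fun_space_independent_familyD:
  fixes g :: "'i \<Rightarrow> 'a \<Rightarrow> 'k::field"
  assumes "finite C" and "inj_on g C" and "fun_space.independent (g ` C)"
    and "\<And>x. (\<Sum>j\<in>C. c j * g j x) = 0" and "j \<in> C"
  shows "c j = 0"
proof -
  have "(\<Sum>v\<in>g ` C. (\<lambda>x. c (the_inv_into C g v) * v x)) = 0"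
    using assms(4)
    by (simp add: fun_eq_iff sum_fun_eval sum.reindex[OF assms(2)] the_inv_into_f_f[OF assms(2)])
  then have "c (the_inv_into C g (g j)) = 0"
    using assms(1,3,5) fun_space.independentD[of "g ` C" "g ` C" "\<lambda>v. c (the_inv_into C g v)" "g j"]
    by simp
  then show ?thesis using the_inv_into_f_f[OF assms(2,5)] by simp
qed

lemma fun_space_sum_in_span:
  fixes g :: "'i \<Rightarrow> 'a \<Rightarrow> 'k::field"
  assumes "\<And>i. i \<in> I \<Longrightarrow> g i \<in> fun_space.span S"
  shows "(\<lambda>x. \<Sum>i\<in>I. c i * g i x) \<in> fun_space.span S"
proof -
  have "(\<lambda>x. \<Sum>i\<in>I. c i * g i x) = (\<Sum>i\<in>I. (\<lambda>x. c i * g i x))"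
    by (simp add: fun_eq_iff sum_fun_eval)
  then show ?thesis
    using assms by (auto intro!: fun_space.span_sum fun_space.span_scale)
qed

text \<open>Read \<open>W\<close> as a matrix. The hypothesis is ker (H W) \<subseteq> ker A, hence
  rank A \<le> rank (H W) \<le> rank H. Only kernels are compared, so no factorization of
  \<open>A\<close> through \<open>H\<close> has to be exhibited.\<close>

lemma mat_rank_le_of_kernel:
  fixes A H :: "'k::field mat"
  assumes ker: "\<And>c. (\<And>i. i < dim_row H \<Longrightarrow>
        (\<Sum>k<dim_col A. c k * (\<Sum>j<dim_col H. W j k * H $$ (i, j))) = 0) \<Longrightarrow>
      (\<And>i. i < dim_row A \<Longrightarrow> (\<Sum>k<dim_col A. c k * A $$ (i, k)) = 0)"
  shows "mat_rank A \<le> mat_rank H"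
proof -
  obtain C where C: "independent_columns A C" "card C = mat_rank A"
    using mat_rank_ge_iff[of "mat_rank A" A] by auto
  then have CA: "C \<subseteq> {..<dim_col A}" and finC: "finite C"
    and ind: "\<And>c j. \<forall>i<dim_row A. (\<Sum>j\<in>C. c j * A $$ (i, j)) = 0 \<Longrightarrow> j \<in> C \<Longrightarrow> c j = 0"
    unfolding independent_columns_def using finite_subset by auto
  \<comment> \<open>\<open>?g k\<close> is column \<open>k\<close> of the product H W. By the kernel
    hypothesis, a relation among those with index in \<open>C\<close> would be a relation among the
    columns of \<open>A\<close>.\<close>
  let ?g = "\<lambda>k i. \<Sum>j<dim_col H. W j k * column_fun H j i"
  have ind_g: "c j = 0" if c: "\<And>x. (\<Sum>k\<in>C. c k * ?g k x) = 0" and j: "j \<in> C" for c j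
  proof -
    let ?c = "\<lambda>k. if k \<in> C then c k else 0"
    have ext: "(\<Sum>k<dim_col A. ?c k * f k) = (\<Sum>k\<in>C. c k * f k)" for f
      using CA by (intro sum.mono_neutral_cong_right) auto
    have "(\<Sum>k<dim_col A. ?c k * A $$ (i, k)) = 0" if "i < dim_row A" for i
    proof (rule ker[OF _ that])
      fix i assume "i < dim_row H"
      then show "(\<Sum>k<dim_col A. ?c k * (\<Sum>j<dim_col H. W j k * H $$ (i, j))) = 0"
        unfolding ext using c[of i] by (simp add: column_fun_def)
    qed
    then show ?thesis using ind[of c j] j unfolding ext by blast
  qed
  have indep: "inj_on ?g C" "fun_space.independent (?g ` C)"
    by (rule fun_space_independent_family[OF finC]; rule ind_g; assumption)+
  \<comment> \<open>All \<open>?g k\<close> lie in the span of the columns of \<open>H\<close>, and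
    a basis picked among these columns has at most \<open>mat_rank H\<close> members.\<close>
  let ?X = "column_fun H ` {..<dim_col H}"
  obtain B where B: "B \<subseteq> ?X" "fun_space.independent B" "card B = fun_space.dim ?X"
    using fun_space.basis_exists[of ?X] by metis
  obtain D where D: "D \<subseteq> {..<dim_col H}" "inj_on (column_fun H) D" "B = column_fun H ` D"
    using B(1) by (meson subset_image_inj)
  have "independent_columns H D"
    unfolding independent_columns_def
  proof (intro conjI D(1) allI impI ballI)
    fix c j assume "\<forall>i<dim_row H. (\<Sum>j\<in>D. c j * H $$ (i, j)) = 0" and j: "j \<in> D"
    then have "(\<Sum>j\<in>D. c j * column_fun H j i) = 0" for i
      by (cases "i < dim_row H") (simp_all add: column_fun_def)
    then show "c j = 0"
      using fun_space_independent_familyD[OF _ D(2), of c j] B(2) D(1,3) j finite_subset by blast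
  qed
  then have "card D \<le> mat_rank H" using mat_rank_ge_iff by blast
  moreover have "card (?g ` C) \<le> fun_space.dim ?X"
  proof (rule fun_space.card_independent_le_dim[THEN conjunct2])
    show "?g ` C \<subseteq> fun_space.span ?X"
      by (intro image_subsetI fun_space_sum_in_span fun_space.span_base imageI) simp
    show "fun_space.independent (?g ` C)" by (rule indep(2))
  qed simp
  ultimately show ?thesis
    using B(3) D(2,3) C(2) card_image[OF D(2)] card_image[OF indep(1)] by simp
qed

text \<open>The code below is examined through combinations of rows, that is, through the kernel of
  the transpose; the determinant carries the result back to \<open>A\<close>.\<close>

lemma mat_rank_eq_if_left_kernel_trivial:
  fixes A :: "'k::field mat"
  assumes A: "A \<in> carrier_mat r r"
    and ker: "\<And>x. (\<And>k. k < r \<Longrightarrow> (\<Sum>l<r. x l * A $$ (l, k)) = 0) \<Longrightarrow> (\<And>l. l < r \<Longrightarrow> x l = 0)"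
  shows "mat_rank A = r"
proof -
  interpret vec_space "TYPE('k)" r .
  have "det (transpose_mat A) \<noteq> 0"
  proof
    assume "det (transpose_mat A) = 0"
    moreover have T: "transpose_mat A \<in> carrier_mat r r" using A by simp
    ultimately obtain v where v: "v \<in> carrier_vec r" "v \<noteq> 0\<^sub>v r" "transpose_mat A *\<^sub>v v = 0\<^sub>v r"
      using det_0_iff_vec_prod_zero_field[OF T] by blast
    have "(\<Sum>l<r. v $ l * A $$ (l, k)) = 0" if k: "k < r" for k
    proof -
      have "(transpose_mat A *\<^sub>v v) $ k = (\<Sum>l<r. v $ l * A $$ (l, k))"
        using A v(1) k by (auto simp: scalar_prod_def atLeast0LessThan intro!: sum.cong)
      then show ?thesis using v(3) k by simp
    qed
    then have "v $ l = 0" if "l < r" for l using ker that by blast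
    then have "v = 0\<^sub>v r" using v(1) by auto
    then show False using v(2) by simp
  qed
  then have "det A \<noteq> 0" using det_transpose[OF A] by simp
  then show ?thesis using det_rank_iff[OF A] A by auto
qed

section \<open>The system matrix in terms of ports\<close>

text \<open>Writing A = 1 A compares \<open>A\<close> with the identity, which has as many columns
  as \<open>A\<close> has rows. Applied to the cut around S alone, this bounds the minimum cut by
  the number of outputs of S.\<close>

lemma mat_rank_le_dim_row: "mat_rank A \<le> dim_row (A :: 'k::field mat)"
proof -
  interpret vec_space "TYPE('k)" "dim_row A" .
  have "mat_rank A \<le> mat_rank (1\<^sub>m (dim_row A) :: 'k mat)"
  proof (rule mat_rank_le_of_kernel[where W = "\<lambda>j k. A $$ (j, k)"])
    fix c i
    assume c: "\<And>i. i < dim_row (1\<^sub>m (dim_row A) :: 'k mat) \<Longrightarrow>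
      (\<Sum>k<dim_col A. c k * (\<Sum>j<dim_col (1\<^sub>m (dim_row A) :: 'k mat).
        A $$ (j, k) * 1\<^sub>m (dim_row A) $$ (i, j))) = 0"
      and i: "i < dim_row A"
    have "(\<Sum>j<dim_row A. A $$ (j, k) * 1\<^sub>m (dim_row A) $$ (i, j)) = A $$ (i, k)" for k
    proof -
      have "(\<Sum>j<dim_row A. A $$ (j, k) * 1\<^sub>m (dim_row A) $$ (i, j)) =
          (\<Sum>j<dim_row A. if i = j then A $$ (j, k) else 0)"
        using i by (intro sum.cong) auto
      then show ?thesis using i by simp
    qed
    then show "(\<Sum>k<dim_col A. c k * A $$ (i, k)) = 0"
      using c[of i] i by simp
  qed
  also have "\<dots> \<le> dim_row A"
    using rank_le_nc[of "1\<^sub>m (dim_row A)" "dim_row A"] by simp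
  finally show ?thesis .
qed

lemma sum_nth_distinct:
  "distinct xs \<Longrightarrow> (\<Sum>i<length xs. g (xs ! i)) = (\<Sum>x\<in>set xs. g x)"
  by (rule sum.reindex_bij_betw) (auto intro: bij_betw_nth)

lemma wf_networkD:
  assumes "wf_network H"
  shows "finite (nodes H)"
    and "V \<in> nodes H \<Longrightarrow> finite (inp H V)" and "V \<in> nodes H \<Longrightarrow> finite (outp H V)"
    and "V \<in> nodes H \<Longrightarrow> W \<in> nodes H \<Longrightarrow> e \<in> inp H V \<Longrightarrow> e \<notin> outp H W"
    and "V \<in> nodes H \<Longrightarrow> W \<in> nodes H \<Longrightarrow> e \<in> inp H V \<Longrightarrow> e \<in> inp H W \<Longrightarrow> V = W"
    and "V \<in> nodes H \<Longrightarrow> W \<in> nodes H \<Longrightarrow> e \<in> outp H V \<Longrightarrow> e \<in> outp H W \<Longrightarrow> V = W"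
    and "(e, e') \<in> edges H \<Longrightarrow> \<exists>V\<in>nodes H. e \<in> outp H V"
    and "(e, e') \<in> edges H \<Longrightarrow> \<exists>V\<in>nodes H. e' \<in> inp H V"
    and "distinct (ports H)"
    and "V \<in> nodes H \<Longrightarrow> e \<in> inp H V \<Longrightarrow> e \<in> set (ports H)"
    and "V \<in> nodes H \<Longrightarrow> e \<in> outp H V \<Longrightarrow> e \<in> set (ports H)"
    and "e \<in> set (ports H) \<Longrightarrow> \<exists>V\<in>nodes H. e \<in> inp H V \<or> e \<in> outp H V"
proof -
  have fin: "finite (nodes H)" "\<forall>V\<in>nodes H. finite (inp H V) \<and> finite (outp H V)" "distinct (ports H)"
    and io: "\<forall>V\<in>nodes H. \<forall>W\<in>nodes H. inp H V \<inter> outp H W = {}"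
    and same: "\<forall>V\<in>nodes H. \<forall>W\<in>nodes H. V \<noteq> W \<longrightarrow> inp H V \<inter> inp H W = {} \<and> outp H V \<inter> outp H W = {}"
    and sub: "edges H \<subseteq> (\<Union>V\<in>nodes H. outp H V) \<times> (\<Union>V\<in>nodes H. inp H V)"
    and ports: "set (ports H) = (\<Union>V\<in>nodes H. inp H V \<union> outp H V)"
    using assms unfolding wf_network_def by simp_all
  show "finite (nodes H)" "V \<in> nodes H \<Longrightarrow> finite (inp H V)" "V \<in> nodes H \<Longrightarrow> finite (outp H V)"
    "distinct (ports H)"
    using fin by simp_all
  show "V \<in> nodes H \<Longrightarrow> W \<in> nodes H \<Longrightarrow> e \<in> inp H V \<Longrightarrow> e \<notin> outp H W"
    using io by (meson disjoint_iff)
  show "V \<in> nodes H \<Longrightarrow> W \<in> nodes H \<Longrightarrow> e \<in> inp H V \<Longrightarrow> e \<in> inp H W \<Longrightarrow> V = W"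
    using same by (meson disjoint_iff)
  show "V \<in> nodes H \<Longrightarrow> W \<in> nodes H \<Longrightarrow> e \<in> outp H V \<Longrightarrow> e \<in> outp H W \<Longrightarrow> V = W"
    using same by (meson disjoint_iff)
  show "(e, e') \<in> edges H \<Longrightarrow> \<exists>V\<in>nodes H. e \<in> outp H V"
    "(e, e') \<in> edges H \<Longrightarrow> \<exists>V\<in>nodes H. e' \<in> inp H V"
    using sub by auto
  show "V \<in> nodes H \<Longrightarrow> e \<in> inp H V \<Longrightarrow> e \<in> set (ports H)"
    "V \<in> nodes H \<Longrightarrow> e \<in> outp H V \<Longrightarrow> e \<in> set (ports H)"
    "e \<in> set (ports H) \<Longrightarrow> \<exists>V\<in>nodes H. e \<in> inp H V \<or> e \<in> outp H V"
    unfolding ports by auto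
qed

definition F_coeff :: "('v, 'p) network \<Rightarrow> ('p \<times> 'p \<Rightarrow> 'k::field) \<Rightarrow> 'p \<Rightarrow> 'p \<Rightarrow> 'k" where
  "F_coeff H \<beta> e e' =
     (if (e, e') \<in> edges H then 1
      else if \<exists>V\<in>nodes H. e \<in> inp H V \<and> e' \<in> outp H V then \<beta> (e, e') else 0)"

lemma F_matrix_index:
  "i < length (ports H) \<Longrightarrow> j < length (ports H) \<Longrightarrow>
     F_matrix H \<beta> $$ (i, j) = F_coeff H \<beta> (ports H ! i) (ports H ! j)"
  by (simp add: F_matrix_def F_coeff_def)

text \<open>Disjointness of the port sets means that knowing one end of a pair rules out one kind of
  entry: rows of outputs and columns of inputs contain edges only, rows of inputs and columns of
  outputs relay coefficients only. This and the next three lemmas are the four cases.\<close>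

lemma F_coeff_outp:
  assumes wf: "wf_network H" and "V \<in> nodes H" and "e \<in> outp H V"
  shows "F_coeff H \<beta> e e' = (if (e, e') \<in> edges H then 1 else 0)"
proof -
  have "\<not> (\<exists>W\<in>nodes H. e \<in> inp H W \<and> e' \<in> outp H W)"
    using assms(2,3) wf_networkD(4)[OF wf] by blast
  then show ?thesis by (auto simp: F_coeff_def)
qed

lemma F_coeff_to_inp:
  assumes wf: "wf_network H" and "V \<in> nodes H" and "e' \<in> inp H V"
  shows "F_coeff H \<beta> e e' = (if (e, e') \<in> edges H then 1 else 0)"
proof -
  have "\<not> (\<exists>W\<in>nodes H. e \<in> inp H W \<and> e' \<in> outp H W)"
    using assms(2,3) wf_networkD(4)[OF wf] by blast
  then show ?thesis by (auto simp: F_coeff_def)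
qed

lemma F_coeff_inp:
  assumes wf: "wf_network H" and V: "V \<in> nodes H" "e \<in> inp H V"
  shows "F_coeff H \<beta> e e' = (if e' \<in> outp H V then \<beta> (e, e') else 0)"
proof -
  have "(e, e') \<notin> edges H"
    using wf_networkD(4,7)[OF wf] V by blast
  moreover have "W = V" if "W \<in> nodes H" "e \<in> inp H W" for W
    using wf_networkD(5)[OF wf] V that by blast
  ultimately have "(\<exists>W\<in>nodes H. e \<in> inp H W \<and> e' \<in> outp H W) \<longleftrightarrow> e' \<in> outp H V"
    and "(e, e') \<notin> edges H" using V by blast+
  then show ?thesis by (simp add: F_coeff_def)
qed

lemma F_coeff_to_outp:
  assumes wf: "wf_network H" and V: "V \<in> nodes H" "e' \<in> outp H V"
  shows "F_coeff H \<beta> e e' = (if e \<in> inp H V then \<beta> (e, e') else 0)"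
proof -
  have "(e, e') \<notin> edges H"
    using wf_networkD(4,8)[OF wf] V by blast
  moreover have "W = V" if "W \<in> nodes H" "e' \<in> outp H W" for W
    using wf_networkD(6)[OF wf] V that by blast
  ultimately have "(\<exists>W\<in>nodes H. e \<in> inp H W \<and> e' \<in> outp H W) \<longleftrightarrow> e \<in> inp H V"
    and "(e, e') \<notin> edges H" using V by blast+
  then show ?thesis by (simp add: F_coeff_def)
qed

text \<open>Injectivity of I - F on functions of ports: acyclicity leaves no nonzero signal that
  sustains itself. It is applied to the part of the network inside a cut.\<close>

lemma port_system_kernel:
  fixes v :: "'p \<Rightarrow> 'k::field"
  assumes wf: "wf_network H" and ac: "acyclic_network H"
    and v: "\<And>e. e \<in> set (ports H) \<Longrightarrow> v e = (\<Sum>e'\<in>set (ports H). F_coeff H \<beta> e e' * v e')"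
    and e: "e \<in> set (ports H)"
  shows "v e = 0"
proof -
  have eq: "v (ports H ! i) = (\<Sum>j<length (ports H). F_matrix H \<beta> $$ (i, j) * v (ports H ! j))"
    if i: "i < length (ports H)" for i
  proof -
    have "v (ports H ! i) =
        (\<Sum>j<length (ports H). F_coeff H \<beta> (ports H ! i) (ports H ! j) * v (ports H ! j))"
      using v[of "ports H ! i"] i wf_networkD(9)[OF wf]
      by (simp add: sum_nth_distinct[where g = "\<lambda>e'. F_coeff H \<beta> (ports H ! i) e' * v e'"])
    then show ?thesis using i by (simp add: F_matrix_index cong: sum.cong_simp)
  qed
  obtain V where "V \<in> nodes H" "e \<in> inp H V \<union> outp H V"
    using wf_networkD(12)[OF wf e] by blast
  moreover obtain i where "i < length (ports H)" "e = ports H ! i"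
    using e by (metis in_set_conv_nth)
  ultimately show ?thesis
    using I_minus_F_kernel[OF wf ac, where v = "\<lambda>i. v (ports H ! i)"] eq by blast
qed

lemma minus_add_mat_cancel:
  fixes A B :: "'k::ab_group_add mat"
  assumes "A \<in> carrier_mat nr nc" and "B \<in> carrier_mat nr nc"
  shows "A - B + B = A"
  by (rule eq_matI) (use assms in auto)

text \<open>The two bracketings of the triple product: \<open>U\<close> = A (I - F)^-1 collects
  forward signals, \<open>W\<close> = (I - F)^-1 B^T backward gains. Their fixed-point equations are
  all that is used of the inverse afterwards.\<close>

lemma system_matrix_factor:
  fixes \<beta> :: "'p \<times> 'p \<Rightarrow> 'k::field"
  assumes wf: "wf_network H" and ac: "acyclic_network H"
  defines "n \<equiv> length (ports H)"
  obtains U W where "U \<in> carrier_mat \<mu> n" and "W \<in> carrier_mat n \<nu>"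
    and "U = A_matrix H S \<mu> \<alpha> + U * F_matrix H \<beta>"
    and "W = transpose_mat (B_matrix H T \<nu> \<epsilon>) + F_matrix H \<beta> * W"
    and "system_matrix H S T \<mu> \<nu> \<alpha> \<beta> \<epsilon> = U * transpose_mat (B_matrix H T \<nu> \<epsilon>)"
    and "system_matrix H S T \<mu> \<nu> \<alpha> \<beta> \<epsilon> = A_matrix H S \<mu> \<alpha> * W"
proof -
  let ?A = "A_matrix H S \<mu> \<alpha>" and ?F = "F_matrix H \<beta>" and ?B = "transpose_mat (B_matrix H T \<nu> \<epsilon>)"
  obtain X where X: "mat_inverse (1\<^sub>m n - ?F) = Some X"
    using mat_inverse_I_minus_F[OF wf ac, of \<beta>] unfolding n_def by (rule exE)
  have cA: "?A \<in> carrier_mat \<mu> n" and cF: "?F \<in> carrier_mat n n" and cB: "?B \<in> carrier_mat n \<nu>"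
    by (auto simp: A_matrix_def F_matrix_def B_matrix_def n_def)
  have cI: "1\<^sub>m n - ?F \<in> carrier_mat n n" using cF by auto
  have inv: "(1\<^sub>m n - ?F) * X = 1\<^sub>m n" "X * (1\<^sub>m n - ?F) = 1\<^sub>m n" and cX: "X \<in> carrier_mat n n"
    using mat_inverse(2)[OF cI X] by auto
  have cFX: "?F * X \<in> carrier_mat n n" "X * ?F \<in> carrier_mat n n" using cF cX by auto
  have e1: "X - ?F * X = 1\<^sub>m n"
    using inv(1) cF cX minus_mult_distrib_mat[of "1\<^sub>m n" n n ?F X n] by simp
  have e2: "X - X * ?F = 1\<^sub>m n"
    using inv(2) cF cX mult_minus_distrib_mat[of X n n "1\<^sub>m n" n ?F] by simp
  have "X - ?F * X + ?F * X = X" "X - X * ?F + X * ?F = X"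
    by (rule minus_add_mat_cancel[OF cX cFX(1)], rule minus_add_mat_cancel[OF cX cFX(2)])
  then have eq: "1\<^sub>m n + ?F * X = X" "1\<^sub>m n + X * ?F = X"
    unfolding e1 e2 .
  show ?thesis
  proof (rule that[of "?A * X" "X * ?B"])
    show "?A * X \<in> carrier_mat \<mu> n" "X * ?B \<in> carrier_mat n \<nu>" using cA cX cB by auto
    have "?A * X = ?A * (1\<^sub>m n + X * ?F)" unfolding eq(2) ..
    also have "\<dots> = ?A + ?A * X * ?F"
      using cA cX cF cFX by (simp add: mult_add_distrib_mat[OF cA one_carrier_mat cFX(2)])
    finally show "?A * X = ?A + ?A * X * ?F" .
    have "X * ?B = (1\<^sub>m n + ?F * X) * ?B" unfolding eq(1) ..
    also have "\<dots> = ?B + ?F * (X * ?B)"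
      using cB cX cF cFX by (simp add: add_mult_distrib_mat[OF one_carrier_mat cFX(1) cB])
    finally show "X * ?B = ?B + ?F * (X * ?B)" .
    show "system_matrix H S T \<mu> \<nu> \<alpha> \<beta> \<epsilon> = ?A * X * ?B"
      using X by (simp add: system_matrix_def n_def)
    then show "system_matrix H S T \<mu> \<nu> \<alpha> \<beta> \<epsilon> = ?A * (X * ?B)"
      using cA cX cB by simp
  qed
qed

lemma system_matrix_dim [simp]:
  "dim_row (system_matrix H S T \<mu> \<nu> \<alpha> \<beta> \<epsilon>) = \<mu>"
  "dim_col (system_matrix H S T \<mu> \<nu> \<alpha> \<beta> \<epsilon>) = \<nu>"
  by (simp_all add: system_matrix_def A_matrix_def B_matrix_def)

lemma mat_mult_index_sum:
  "A \<in> carrier_mat a n \<Longrightarrow> B \<in> carrier_mat n b \<Longrightarrow> i < a \<Longrightarrow> j < b \<Longrightarrow>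
     (A * B) $$ (i, j) = (\<Sum>l<n. A $$ (i, l) * B $$ (l, j))"
  by (auto simp: scalar_prod_def atLeast0LessThan intro!: sum.cong)

lemma ports_index:
  assumes "wf_network H"
  obtains ix where "\<And>e. e \<in> set (ports H) \<Longrightarrow> ix e < length (ports H) \<and> ports H ! ix e = e"
    and "\<And>i. i < length (ports H) \<Longrightarrow> ix (ports H ! i) = i"
proof -
  have bij: "bij_betw ((!) (ports H)) {..<length (ports H)} (set (ports H))"
    using wf_networkD(9)[OF assms] by (intro bij_betw_nth) auto
  show ?thesis
  proof (rule that[of "the_inv_into {..<length (ports H)} ((!) (ports H))"])
    fix e assume "e \<in> set (ports H)"
    then show "the_inv_into {..<length (ports H)} ((!) (ports H)) e < length (ports H) \<and>
        ports H ! the_inv_into {..<length (ports H)} ((!) (ports H)) e = e"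
      using bij f_the_inv_into_f_bij_betw[OF bij] the_inv_into_into[of "(!) (ports H)" "{..<length (ports H)}" e]
      unfolding bij_betw_def by auto
  qed (use bij in \<open>auto simp: bij_betw_def the_inv_into_f_f\<close>)
qed

text \<open>\<open>w e k\<close> is the gain from port \<open>e\<close> to destination process
  \<open>k\<close>, expressed through the gains of the ports fed by \<open>e\<close>. This suits the
  upper bound, where a cut is crossed backwards from T.\<close>

lemma system_matrix_columns:
  fixes \<beta> :: "'p \<times> 'p \<Rightarrow> 'k::field"
  assumes wf: "wf_network H" and ac: "acyclic_network H"
  shows "\<exists>w.
    (\<forall>e\<in>set (ports H). \<forall>k<\<nu>. w e k =
       (if e \<in> inp H T then \<epsilon> (e, T, k) else 0) + (\<Sum>e'\<in>set (ports H). F_coeff H \<beta> e e' * w e' k)) \<and>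
    (\<forall>l<\<mu>. \<forall>k<\<nu>. system_matrix H S T \<mu> \<nu> \<alpha> \<beta> \<epsilon> $$ (l, k) =
       (\<Sum>e\<in>set (ports H). (if e \<in> outp H S then \<alpha> (l, e) else 0) * w e k))"
proof -
  let ?n = "length (ports H)"
  obtain U W where "U \<in> carrier_mat \<mu> ?n" and W: "W \<in> carrier_mat ?n \<nu>"
    and "U = A_matrix H S \<mu> \<alpha> + U * F_matrix H \<beta>"
    and W_eq: "W = transpose_mat (B_matrix H T \<nu> \<epsilon>) + F_matrix H \<beta> * W"
    and "system_matrix H S T \<mu> \<nu> \<alpha> \<beta> \<epsilon> = U * transpose_mat (B_matrix H T \<nu> \<epsilon>)"
    and M: "system_matrix H S T \<mu> \<nu> \<alpha> \<beta> \<epsilon> = A_matrix H S \<mu> \<alpha> * W"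
    by (rule system_matrix_factor[OF wf ac])
  obtain ix where ix: "\<And>e. e \<in> set (ports H) \<Longrightarrow> ix e < ?n \<and> ports H ! ix e = e"
    "\<And>i. i < ?n \<Longrightarrow> ix (ports H ! i) = i"
    using ports_index[OF wf] by blast
  have cF: "F_matrix H \<beta> \<in> carrier_mat ?n ?n" and cA: "A_matrix H S \<mu> \<alpha> \<in> carrier_mat \<mu> ?n"
    by (simp_all add: F_matrix_def A_matrix_def)
  have conv: "(\<Sum>j<?n. g (ports H ! j) * W $$ (j, k)) = (\<Sum>e\<in>set (ports H). g e * W $$ (ix e, k))" for g k
    using sum_nth_distinct[OF wf_networkD(9)[OF wf], of "\<lambda>e. g e * W $$ (ix e, k)"] ix(2)
    by (simp cong: sum.cong_simp)
  show ?thesis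
  proof (intro exI[of _ "\<lambda>e k. W $$ (ix e, k)"] conjI ballI allI impI)
    fix e k assume e: "e \<in> set (ports H)" and k: "k < \<nu>"
    have i: "ix e < ?n" "ports H ! ix e = e" using ix(1)[OF e] by auto
    have "W $$ (ix e, k) = (transpose_mat (B_matrix H T \<nu> \<epsilon>) + F_matrix H \<beta> * W) $$ (ix e, k)"
      using W_eq by simp
    also have "\<dots> = (transpose_mat (B_matrix H T \<nu> \<epsilon>)) $$ (ix e, k) + (F_matrix H \<beta> * W) $$ (ix e, k)"
      using i k W cF by simp
    also have "(F_matrix H \<beta> * W) $$ (ix e, k) = (\<Sum>j<?n. F_coeff H \<beta> e (ports H ! j) * W $$ (j, k))"
      using mat_mult_index_sum[OF cF W i(1) k] i by (simp add: F_matrix_index cong: sum.cong_simp)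
    also have "transpose_mat (B_matrix H T \<nu> \<epsilon>) $$ (ix e, k) = (if e \<in> inp H T then \<epsilon> (e, T, k) else 0)"
      using i k by (simp add: B_matrix_def)
    finally show "W $$ (ix e, k) = (if e \<in> inp H T then \<epsilon> (e, T, k) else 0) +
        (\<Sum>e'\<in>set (ports H). F_coeff H \<beta> e e' * W $$ (ix e', k))"
      unfolding conv .
  next
    fix l k assume l: "l < \<mu>" and k: "k < \<nu>"
    have "system_matrix H S T \<mu> \<nu> \<alpha> \<beta> \<epsilon> $$ (l, k) =
        (\<Sum>j<?n. (if ports H ! j \<in> outp H S then \<alpha> (l, ports H ! j) else 0) * W $$ (j, k))"
      unfolding M using mat_mult_index_sum[OF cA W l k] l
      by (simp add: A_matrix_def cong: sum.cong_simp)
    then show "system_matrix H S T \<mu> \<nu> \<alpha> \<beta> \<epsilon> $$ (l, k) =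
        (\<Sum>e\<in>set (ports H). (if e \<in> outp H S then \<alpha> (l, e) else 0) * W $$ (ix e, k))"
      using conv[of "\<lambda>e. if e \<in> outp H S then \<alpha> (l, e) else 0"] by simp
  qed
qed

text \<open>\<open>u l e\<close> is the signal on port \<open>e\<close> when source process
  \<open>l\<close> sends 1 and the others 0, expressed through the ports that feed \<open>e\<close>.
  This forward view serves the lower bound.\<close>

lemma system_matrix_rows:
  fixes \<beta> :: "'p \<times> 'p \<Rightarrow> 'k::field"
  assumes wf: "wf_network H" and ac: "acyclic_network H"
  shows "\<exists>u.
    (\<forall>l<\<mu>. \<forall>e\<in>set (ports H). u l e =
       (if e \<in> outp H S then \<alpha> (l, e) else 0) + (\<Sum>e'\<in>set (ports H). u l e' * F_coeff H \<beta> e' e)) \<and>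
    (\<forall>l<\<mu>. \<forall>k<\<nu>. system_matrix H S T \<mu> \<nu> \<alpha> \<beta> \<epsilon> $$ (l, k) =
       (\<Sum>e\<in>set (ports H). u l e * (if e \<in> inp H T then \<epsilon> (e, T, k) else 0)))"
proof -
  let ?n = "length (ports H)"
  obtain U W where U: "U \<in> carrier_mat \<mu> ?n" and "W \<in> carrier_mat ?n \<nu>"
    and U_eq: "U = A_matrix H S \<mu> \<alpha> + U * F_matrix H \<beta>"
    and "W = transpose_mat (B_matrix H T \<nu> \<epsilon>) + F_matrix H \<beta> * W"
    and M: "system_matrix H S T \<mu> \<nu> \<alpha> \<beta> \<epsilon> = U * transpose_mat (B_matrix H T \<nu> \<epsilon>)"
    and "system_matrix H S T \<mu> \<nu> \<alpha> \<beta> \<epsilon> = A_matrix H S \<mu> \<alpha> * W"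
    by (rule system_matrix_factor[OF wf ac])
  obtain ix where ix: "\<And>e. e \<in> set (ports H) \<Longrightarrow> ix e < ?n \<and> ports H ! ix e = e"
    "\<And>i. i < ?n \<Longrightarrow> ix (ports H ! i) = i"
    using ports_index[OF wf] by blast
  have cF: "F_matrix H \<beta> \<in> carrier_mat ?n ?n" and cB: "transpose_mat (B_matrix H T \<nu> \<epsilon>) \<in> carrier_mat ?n \<nu>"
    by (simp_all add: F_matrix_def B_matrix_def)
  have conv: "(\<Sum>j<?n. U $$ (l, j) * g (ports H ! j)) = (\<Sum>e\<in>set (ports H). U $$ (l, ix e) * g e)" for g l
    using sum_nth_distinct[OF wf_networkD(9)[OF wf], of "\<lambda>e. U $$ (l, ix e) * g e"] ix(2)
    by (simp cong: sum.cong_simp)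
  show ?thesis
  proof (intro exI[of _ "\<lambda>l e. U $$ (l, ix e)"] conjI ballI allI impI)
    fix e l assume e: "e \<in> set (ports H)" and l: "l < \<mu>"
    have i: "ix e < ?n" "ports H ! ix e = e" using ix(1)[OF e] by auto
    have "U $$ (l, ix e) = (A_matrix H S \<mu> \<alpha> + U * F_matrix H \<beta>) $$ (l, ix e)"
      using U_eq by simp
    also have "\<dots> = A_matrix H S \<mu> \<alpha> $$ (l, ix e) + (U * F_matrix H \<beta>) $$ (l, ix e)"
      using i l U cF by simp
    also have "(U * F_matrix H \<beta>) $$ (l, ix e) = (\<Sum>j<?n. U $$ (l, j) * F_coeff H \<beta> (ports H ! j) e)"
      using mat_mult_index_sum[OF U cF l i(1)] i by (simp add: F_matrix_index cong: sum.cong_simp)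
    also have "\<dots> = (\<Sum>e'\<in>set (ports H). U $$ (l, ix e') * F_coeff H \<beta> e' e)"
      by (rule conv[of l "\<lambda>e'. F_coeff H \<beta> e' e"])
    also have "A_matrix H S \<mu> \<alpha> $$ (l, ix e) = (if e \<in> outp H S then \<alpha> (l, e) else 0)"
      using i l by (simp add: A_matrix_def)
    finally show "U $$ (l, ix e) = (if e \<in> outp H S then \<alpha> (l, e) else 0) +
        (\<Sum>e'\<in>set (ports H). U $$ (l, ix e') * F_coeff H \<beta> e' e)" .
  next
    fix l k assume l: "l < \<mu>" and k: "k < \<nu>"
    have "system_matrix H S T \<mu> \<nu> \<alpha> \<beta> \<epsilon> $$ (l, k) =
        (\<Sum>j<?n. U $$ (l, j) * (if ports H ! j \<in> inp H T then \<epsilon> (ports H ! j, T, k) else 0))"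
      unfolding M using mat_mult_index_sum[OF U cB l k] k
      by (simp add: B_matrix_def cong: sum.cong_simp)
    then show "system_matrix H S T \<mu> \<nu> \<alpha> \<beta> \<epsilon> $$ (l, k) =
        (\<Sum>e\<in>set (ports H). U $$ (l, ix e) * (if e \<in> inp H T then \<epsilon> (e, T, k) else 0))"
      using conv[of l "\<lambda>e. if e \<in> inp H T then \<epsilon> (e, T, k) else 0"] by simp
  qed
qed

section \<open>Every cut bounds the rank\<close>

definition cut_rows :: "('v, 'p) network \<Rightarrow> 'v set \<Rightarrow> 'p list" where
  "cut_rows H \<Omega> = filter (\<lambda>e. \<exists>V\<in>\<Omega>. e \<in> outp H V) (ports H)"

definition cut_cols :: "('v, 'p) network \<Rightarrow> 'v set \<Rightarrow> 'p list" where
  "cut_cols H \<Omega> = filter (\<lambda>e. \<exists>V\<in>nodes H - \<Omega>. e \<in> inp H V) (ports H)"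

lemma cut_matrix_dim [simp]:
  "dim_row (cut_matrix H \<Omega>) = length (cut_rows H \<Omega>)"
  "dim_col (cut_matrix H \<Omega>) = length (cut_cols H \<Omega>)"
  by (simp_all add: cut_matrix_def cut_rows_def cut_cols_def Let_def)

lemma cut_matrix_index:
  "i < length (cut_rows H \<Omega>) \<Longrightarrow> j < length (cut_cols H \<Omega>) \<Longrightarrow>
     cut_matrix H \<Omega> $$ (i, j) = (if (cut_rows H \<Omega> ! i, cut_cols H \<Omega> ! j) \<in> edges H then 1 else 0)"
  by (simp add: cut_matrix_def cut_rows_def cut_cols_def Let_def)

lemma set_cut_rows:
  "wf_network H \<Longrightarrow> \<Omega> \<subseteq> nodes H \<Longrightarrow> set (cut_rows H \<Omega>) = (\<Union>V\<in>\<Omega>. outp H V)"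
  using wf_networkD(11)[of H] by (fastforce simp: cut_rows_def)

lemma set_cut_cols:
  "wf_network H \<Longrightarrow> set (cut_cols H \<Omega>) = (\<Union>V\<in>nodes H - \<Omega>. inp H V)"
  using wf_networkD(10)[of H] by (fastforce simp: cut_cols_def)

lemma distinct_cut_cols: "wf_network H \<Longrightarrow> distinct (cut_cols H \<Omega>)"
  unfolding cut_cols_def by (intro distinct_filter wf_networkD(9))

section \<open>Restriction to one side of a cut\<close>

lemma wf_network_restrict_edges:
  assumes "wf_network H" and "E \<subseteq> edges H"
  shows "wf_network (H\<lparr>edges := E\<rparr>)"
proof -
  have "edges H \<subseteq> (\<Union>V\<in>nodes H. outp H V) \<times> (\<Union>V\<in>nodes H. inp H V)"
    using assms(1) unfolding wf_network_def by simp
  then have "E \<subseteq> (\<Union>V\<in>nodes H. outp H V) \<times> (\<Union>V\<in>nodes H. inp H V)"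
    using assms(2) by (rule subset_trans[rotated])
  then show ?thesis using assms(1) unfolding wf_network_def by simp
qed

lemma acyclic_network_restrict_edges:
  assumes "acyclic_network H" and "E \<subseteq> edges H"
  shows "acyclic_network (H\<lparr>edges := E\<rparr>)"
proof -
  have "arcs (H\<lparr>edges := E\<rparr>) \<subseteq> arcs H"
    using assms(2) by (auto simp: arcs_def)
  then show ?thesis
    using assms(1) acyclic_subset unfolding acyclic_network_def by blast
qed

text \<open>Restricted to the ports of \<open>\<Omega>\<close>, such a \<open>y\<close> solves the homogeneous system of an acyclic network.
  Edges from the complement back into \<open>\<Omega>\<close> do no harm.\<close>

lemma zero_on_source_side:
  fixes y :: "'p \<Rightarrow> 'k::field"
  assumes wf: "wf_network H" and ac: "acyclic_network H" and \<Omega>: "\<Omega> \<subseteq> nodes H"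
    and y: "\<And>V e. V \<in> \<Omega> \<Longrightarrow> e \<in> inp H V \<or> e \<in> outp H V \<Longrightarrow>
      y e = (\<Sum>e'\<in>set (ports H). F_coeff H \<beta> e e' * y e')"
    and cut: "\<And>V e. V \<in> \<Omega> \<Longrightarrow> e \<in> outp H V \<Longrightarrow>
      (\<Sum>e'\<in>set (cut_cols H \<Omega>). (if (e, e') \<in> edges H then 1 else 0) * y e') = 0"
    and V: "V \<in> \<Omega>" and e: "e \<in> outp H V"
  shows "y e = 0"
proof -
  define P where "P e \<longleftrightarrow> (\<exists>V\<in>\<Omega>. e \<in> inp H V \<or> e \<in> outp H V)" for e
  define v where "v e = (if P e then y e else 0)" for e
  \<comment> \<open>With \<open>v\<close> zero outside, an edge entering \<Omega> would impose an
    unwanted equation on its outside output, so such edges are removed. Removed edges leaving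
    \<Omega> end where \<open>v\<close> is zero.\<close>
  define H' where "H' = H\<lparr>edges := {(e, e') \<in> edges H. P e \<and> P e'}\<rparr>"
  have H'_simps: "nodes H' = nodes H" "inp H' = inp H" "outp H' = outp H" "ports H' = ports H"
    "edges H' = {(e, e') \<in> edges H. P e \<and> P e'}"
    by (simp_all add: H'_def)
  have wf': "wf_network H'" and ac': "acyclic_network H'"
    unfolding H'_def
    by (rule wf_network_restrict_edges[OF wf] acyclic_network_restrict_edges[OF ac]; auto)+
  have P_unique: "W \<in> \<Omega>" if "W \<in> nodes H" "P e" "e \<in> inp H W \<or> e \<in> outp H W" for W e
    using that \<Omega> wf_networkD(4,5,6)[OF wf] unfolding P_def by (metis subsetD)
  have "v e = (\<Sum>e'\<in>set (ports H'). F_coeff H' \<beta> e e' * v e')" if e: "e \<in> set (ports H')" for e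
  proof -
    obtain W where W: "W \<in> nodes H" "e \<in> inp H W \<or> e \<in> outp H W"
      using wf_networkD(12)[OF wf] e H'_simps(4) by metis
    consider (inside_out) "W \<in> \<Omega>" "e \<in> outp H W" | (inside_in) "W \<in> \<Omega>" "e \<in> inp H W"
      | (outside) "W \<notin> \<Omega>"
      using W(2) by blast
    then show ?thesis
    proof cases
      case inside_out
      have Pe: "P e" unfolding P_def using inside_out by blast
      let ?N = "\<lambda>e'. if (e, e') \<in> edges H then 1 else (0::'k)"
      have F: "F_coeff H \<beta> e e' = ?N e'" for e'
        by (rule F_coeff_outp[OF wf W(1) inside_out(2)])
      have F': "F_coeff H' \<beta> e e' = (if P e' then ?N e' else 0)" for e'
        using F_coeff_outp[OF wf', of W e \<beta> e'] W(1) inside_out(2) Pe H'_simps by simp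
      have "v e = (\<Sum>e'\<in>set (ports H). ?N e' * y e')"
        using y[of W e] inside_out Pe F by (simp add: v_def)
      \<comment> \<open>An edge from \<open>e\<close> ends at an input of exactly one node
        \<open>X\<close>: the first summand accounts for it if \<open>X\<close> is in \<Omega>, the
        second if not.\<close>
      also have "\<dots> = (\<Sum>e'\<in>set (ports H). ?N e' * v e' + (if e' \<in> set (cut_cols H \<Omega>) then ?N e' * y e' else 0))"
      proof (rule sum.cong[OF refl])
        fix e' assume "e' \<in> set (ports H)"
        show "?N e' * y e' = ?N e' * v e' + (if e' \<in> set (cut_cols H \<Omega>) then ?N e' * y e' else 0)"
        proof (cases "(e, e') \<in> edges H")
          case True
          then obtain X where X: "X \<in> nodes H" "e' \<in> inp H X"
            using wf_networkD(8)[OF wf] by blast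
          have "P e' \<longleftrightarrow> X \<in> \<Omega>" using X P_unique unfolding P_def by blast
          moreover have "e' \<in> set (cut_cols H \<Omega>) \<longleftrightarrow> X \<notin> \<Omega>"
            unfolding set_cut_cols[OF wf] using X wf_networkD(5)[OF wf] by blast
          ultimately show ?thesis by (simp add: v_def)
        qed simp
      qed
      also have "\<dots> = (\<Sum>e'\<in>set (ports H). ?N e' * v e') + (\<Sum>e'\<in>set (cut_cols H \<Omega>). ?N e' * y e')"
        by (simp add: sum.distrib cut_cols_def sum.inter_filter)
      also have "(\<Sum>e'\<in>set (cut_cols H \<Omega>). ?N e' * y e') = 0" using cut inside_out by blast
      also have "(\<Sum>e'\<in>set (ports H). ?N e' * v e') = (\<Sum>e'\<in>set (ports H'). F_coeff H' \<beta> e e' * v e')"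
        unfolding F' H'_simps by (intro sum.cong) (auto simp: v_def)
      finally show ?thesis by simp
    next
      case inside_in
      have Pe: "P e" unfolding P_def using inside_in by blast
      have "v e = (\<Sum>e'\<in>set (ports H). F_coeff H \<beta> e e' * y e')"
        using y[of W e] inside_in Pe by (simp add: v_def)
      also have "\<dots> = (\<Sum>e'\<in>set (ports H'). F_coeff H' \<beta> e e' * v e')"
        unfolding H'_simps(4)
      proof (rule sum.cong[OF refl])
        fix e'
        have "F_coeff H' \<beta> e e' = F_coeff H \<beta> e e'"
          using F_coeff_inp[OF wf W(1) inside_in(2), of \<beta> e'] F_coeff_inp[OF wf', of W e \<beta> e']
            W(1) inside_in(2) H'_simps by simp
        moreover have "y e' = v e'" if "e' \<in> outp H W"
        proof -
          have "P e'" unfolding P_def using that inside_in(1) by blast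
          then show ?thesis by (simp add: v_def)
        qed
        ultimately show "F_coeff H \<beta> e e' * y e' = F_coeff H' \<beta> e e' * v e'"
          using F_coeff_inp[OF wf W(1) inside_in(2), of \<beta> e'] by (cases "e' \<in> outp H W") auto
      qed
      finally show ?thesis .
    next
      case outside
      then have nP: "\<not> P e" using P_unique W by blast
      \<comment> \<open>A nonzero term would need an edge of \<open>H'\<close> or a relay with
        output in \<Omega>; either puts \<open>e\<close> itself among the ports of \<Omega>.\<close>
      have "F_coeff H' \<beta> e e' * v e' = 0" for e'
      proof (rule ccontr)
        assume "F_coeff H' \<beta> e e' * v e' \<noteq> 0"
        then have "P e'" "F_coeff H' \<beta> e e' \<noteq> 0" by (auto simp: v_def split: if_splits)
        then obtain X where X: "X \<in> nodes H" "e \<in> inp H X" "e' \<in> outp H X"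
          using nP unfolding F_coeff_def H'_simps by (auto split: if_splits)
        then have "X \<in> \<Omega>" using P_unique \<open>P e'\<close> by blast
        then show False using X nP unfolding P_def by blast
      qed
      then show ?thesis using nP by (simp add: v_def)
    qed
  qed
  moreover have "e \<in> set (ports H')"
    using wf_networkD(11)[OF wf _ e] V \<Omega> H'_simps(4) by auto
  ultimately have "v e = 0" using port_system_kernel[OF wf' ac', of v \<beta> e] by blast
  moreover have "P e" unfolding P_def using V e by blast
  ultimately show ?thesis by (simp add: v_def)
qed

text \<open>The kernel comparison is used with the gains at the cut columns as \<open>W\<close>. The
  rows of the system matrix read these gains only at the outputs of S, which lie on the \<Omega>
  side.\<close>

lemma rank_system_matrix_le_cut:
  fixes \<beta> :: "'p \<times> 'p \<Rightarrow> 'k::field"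
  assumes wf: "wf_network H" and ac: "acyclic_network H"
    and \<Omega>: "\<Omega> \<subseteq> nodes H" "S \<in> \<Omega>" "T \<notin> \<Omega>" and T: "T \<in> nodes H"
  shows "mat_rank (system_matrix H S T \<mu> \<nu> \<alpha> \<beta> \<epsilon>) \<le> mat_rank (cut_matrix H \<Omega> :: 'k mat)"
proof -
  let ?M = "system_matrix H S T \<mu> \<nu> \<alpha> \<beta> \<epsilon>"
  obtain w where w: "\<forall>e\<in>set (ports H). \<forall>k<\<nu>. w e k =
       (if e \<in> inp H T then \<epsilon> (e, T, k) else 0) + (\<Sum>e'\<in>set (ports H). F_coeff H \<beta> e e' * w e' k)"
    and M: "\<forall>l<\<mu>. \<forall>k<\<nu>. ?M $$ (l, k) =
       (\<Sum>e\<in>set (ports H). (if e \<in> outp H S then \<alpha> (l, e) else 0) * w e k)"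
    using system_matrix_columns[OF wf ac, of \<nu> T \<epsilon> \<beta> \<mu> S \<alpha>] by (elim exE conjE)
  show ?thesis
  proof (rule mat_rank_le_of_kernel[where W = "\<lambda>j k. w (cut_cols H \<Omega> ! j) k"])
    fix c i
    assume c: "\<And>i. i < dim_row (cut_matrix H \<Omega> :: 'k mat) \<Longrightarrow>
        (\<Sum>k<dim_col ?M. c k * (\<Sum>j<dim_col (cut_matrix H \<Omega> :: 'k mat).
          w (cut_cols H \<Omega> ! j) k * cut_matrix H \<Omega> $$ (i, j))) = 0"
      and i: "i < dim_row ?M"
    define y where "y e = (\<Sum>k<\<nu>. c k * w e k)" for e
    have "y e = 0" if e: "e \<in> outp H S" for e
    proof (rule zero_on_source_side[OF wf ac \<Omega>(1) _ _ \<Omega>(2) e])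
      fix V e assume V: "V \<in> \<Omega>" and e: "e \<in> inp H V \<or> e \<in> outp H V"
      have VN: "V \<in> nodes H" "V \<noteq> T" using V \<Omega> by auto
      \<comment> \<open>The inputs of T are the only ports with an inhomogeneous term, and T lies
        outside \<Omega>.\<close>
      then have nT: "e \<notin> inp H T" using e wf_networkD(4,5)[OF wf] T by blast
      have eN: "e \<in> set (ports H)" using e wf_networkD(10,11)[OF wf VN(1)] by blast
      have "w e k = (\<Sum>e'\<in>set (ports H). F_coeff H \<beta> e e' * w e' k)" if "k < \<nu>" for k
        using w[rule_format, OF eN that] nT by simp
      then have "y e = (\<Sum>k<\<nu>. c k * (\<Sum>e'\<in>set (ports H). F_coeff H \<beta> e e' * w e' k))"
        unfolding y_def by (intro sum.cong) simp_all
      also have "\<dots> = (\<Sum>e'\<in>set (ports H). F_coeff H \<beta> e e' * y e')"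
        unfolding y_def sum_distrib_left by (subst sum.swap) (simp add: mult_ac)
      finally show "y e = (\<Sum>e'\<in>set (ports H). F_coeff H \<beta> e e' * y e')" .
    next
      fix V e assume V: "V \<in> \<Omega>" and e: "e \<in> outp H V"
      then have "e \<in> set (cut_rows H \<Omega>)" using set_cut_rows[OF wf \<Omega>(1)] by blast
      then obtain i where i: "i < length (cut_rows H \<Omega>)" "cut_rows H \<Omega> ! i = e"
        by (metis in_set_conv_nth)
      let ?N = "\<lambda>e'. if (e, e') \<in> edges H then 1 else (0::'k)"
      have "(\<Sum>e'\<in>set (cut_cols H \<Omega>). ?N e' * y e') = (\<Sum>j<length (cut_cols H \<Omega>). ?N (cut_cols H \<Omega> ! j) * y (cut_cols H \<Omega> ! j))"
        by (rule sum_nth_distinct[OF distinct_cut_cols[OF wf], symmetric])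
      also have "\<dots> = (\<Sum>j<length (cut_cols H \<Omega>). \<Sum>k<\<nu>. c k * (w (cut_cols H \<Omega> ! j) k * cut_matrix H \<Omega> $$ (i, j)))"
        using i by (intro sum.cong) (auto simp: y_def cut_matrix_index)
      also have "\<dots> = (\<Sum>k<\<nu>. c k * (\<Sum>j<length (cut_cols H \<Omega>). w (cut_cols H \<Omega> ! j) k * cut_matrix H \<Omega> $$ (i, j)))"
        by (subst sum.swap) (simp add: sum_distrib_left)
      also have "\<dots> = 0" using c[of i] i(1) by simp
      finally show "(\<Sum>e'\<in>set (cut_cols H \<Omega>). ?N e' * y e') = 0" .
    qed
    note y0 = this
    have "(\<Sum>k<\<nu>. c k * ?M $$ (i, k)) =
        (\<Sum>k<\<nu>. c k * (\<Sum>e\<in>set (ports H). (if e \<in> outp H S then \<alpha> (i, e) else 0) * w e k))"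
      using M i by (intro sum.cong) auto
    also have "\<dots> = (\<Sum>e\<in>set (ports H). (if e \<in> outp H S then \<alpha> (i, e) else 0) * y e)"
      unfolding y_def sum_distrib_left by (subst sum.swap) (simp add: mult_ac)
    also have "\<dots> = 0" using y0 by (intro sum.neutral) auto
    finally show "(\<Sum>k<dim_col ?M. c k * ?M $$ (i, k)) = 0" by simp
  qed
qed

section \<open>A code achieving the minimum cut\<close>

definition unit_fun :: "'p \<Rightarrow> 'p \<Rightarrow> 'k::field" where
  "unit_fun o' = (\<lambda>x. if x = o' then 1 else 0)"

text \<open>The unknowns of the lower bound. Outputs of T are absent because the code keeps them
  silent.\<close>

definition other_outputs :: "('v, 'p) network \<Rightarrow> 'v \<Rightarrow> 'p set" where
  "other_outputs H T = (\<Union>V\<in>nodes H - {T}. outp H V)"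

text \<open>Pairing it with the signals on these outputs gives the signal received at
  \<open>i\<close>.\<close>

definition input_column :: "('v, 'p) network \<Rightarrow> 'v \<Rightarrow> 'p \<Rightarrow> 'p \<Rightarrow> 'k::field" where
  "input_column H T i = (\<lambda>x. if x \<in> other_outputs H T \<and> (x, i) \<in> edges H then 1 else 0)"

text \<open>The union over all owners of \<open>x\<close> avoids choosing one; in a well-formed
  network there is at most one.\<close>

definition co_inputs :: "('v, 'p) network \<Rightarrow> 'p \<Rightarrow> 'p set" where
  "co_inputs H x = (\<Union>V\<in>{V \<in> nodes H. x \<in> outp H V}. inp H V)"

lemma finite_other_outputs:
  assumes "wf_network H"
  shows "finite (other_outputs H T)"
  unfolding other_outputs_def using wf_networkD(1,3)[OF assms] by (intro finite_UN_I) auto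

lemma finite_co_inputs:
  assumes "wf_network H"
  shows "finite (co_inputs H x)"
  unfolding co_inputs_def using wf_networkD(1,2)[OF assms] by (intro finite_UN_I) auto

lemma co_inputs_eq:
  assumes "wf_network H" and "V \<in> nodes H" and "x \<in> outp H V"
  shows "co_inputs H x = inp H V"
proof -
  have "{W \<in> nodes H. x \<in> outp H W} = {V}"
    using assms wf_networkD(6)[OF assms(1)] by blast
  then show ?thesis by (simp add: co_inputs_def)
qed

lemma inj_unit_fun: "inj (unit_fun :: 'p \<Rightarrow> 'p \<Rightarrow> 'k::field)"
proof (rule injI)
  fix a b :: 'p assume "(unit_fun a :: 'p \<Rightarrow> 'k) = unit_fun b"
  then have "(unit_fun a :: 'p \<Rightarrow> 'k) a = unit_fun b a" by simp
  then show "a = b" by (simp add: unit_fun_def split: if_splits)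
qed

lemma sum_unit_fun:
  assumes "finite Q"
  shows "(\<Sum>q\<in>Q. c q * (unit_fun q x :: 'k::field)) = (if x \<in> Q then c x else 0)"
proof -
  have "(\<Sum>q\<in>Q. c q * (unit_fun q x :: 'k)) = (\<Sum>q\<in>Q. if x = q then c q else 0)"
    by (intro sum.cong) (auto simp: unit_fun_def)
  then show ?thesis using assms by simp
qed

lemma independent_unit_fun:
  assumes "finite Q"
  shows "fun_space.independent ((unit_fun :: 'p \<Rightarrow> 'p \<Rightarrow> 'k::field) ` Q)"
proof (rule fun_space_independent_family(2)[OF assms])
  fix c j assume c: "\<And>x. (\<Sum>j\<in>Q. c j * (unit_fun j x :: 'k)) = 0" and j: "j \<in> Q"
  show "c j = 0" using c[of j] j by (simp add: sum_unit_fun[OF assms])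
qed

text \<open>As many independent functions supported in \<open>Q\<close> as \<open>Q\<close> has
  elements form a basis of all functions supported there. The functional given by \<open>u\<close>
  thus vanishes on unit functions too, where its values are those of \<open>u\<close>.\<close>

lemma functional_eq_zero:
  fixes u :: "'p \<Rightarrow> 'k::field"
  assumes Q: "finite Q" and X: "fun_space.independent X" "finite X" "card X = card Q"
    and supp: "\<And>v x. v \<in> X \<Longrightarrow> x \<notin> Q \<Longrightarrow> v x = 0"
    and u: "\<And>v. v \<in> X \<Longrightarrow> (\<Sum>q\<in>Q. u q * v q) = 0"
    and q: "q \<in> Q"
  shows "u q = 0"
proof -
  let ?E = "unit_fun ` Q :: ('p \<Rightarrow> 'k) set"
  have XE: "X \<subseteq> fun_space.span ?E"
  proof
    fix v assume v: "v \<in> X"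
    have "v x = (\<Sum>q\<in>Q. v q * unit_fun q x)" for x
      using supp[OF v] by (simp add: sum_unit_fun[OF Q])
    then have "v = (\<lambda>x. \<Sum>q\<in>Q. v q * unit_fun q x)" by blast
    moreover have "(\<lambda>x. \<Sum>q\<in>Q. v q * unit_fun q x) \<in> fun_space.span ?E"
      by (intro fun_space_sum_in_span fun_space.span_base imageI)
    ultimately show "v \<in> fun_space.span ?E" by simp
  qed
  have eq: "unit_fun q \<in> fun_space.span X"
  proof (rule ccontr)
    \<comment> \<open>Otherwise card Q + 1 independent functions would lie in the span of card Q
      unit functions.\<close>
    assume n: "unit_fun q \<notin> fun_space.span X"
    then have "fun_space.independent (insert (unit_fun q) X)"
      using X(1) fun_space.independent_insertI by blast
    moreover have "insert (unit_fun q) X \<subseteq> fun_space.span ?E"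
      using XE q fun_space.span_base by blast
    ultimately have "card (insert (unit_fun q) X) \<le> card ?E"
      using fun_space.independent_span_bound[of ?E] Q by blast
    also have "\<dots> \<le> card Q" using Q by (rule card_image_le)
    finally show False
      using X(2,3) n fun_space.span_base by (metis card_insert_disjoint not_less_eq_eq order_refl)
  qed
  let ?K = "{v. (\<Sum>q\<in>Q. u q * v q) = 0}"
  have "fun_space.subspace ?K"
  proof (rule fun_space.subspaceI)
    fix v w :: "'p \<Rightarrow> 'k" and c
    show "0 \<in> ?K" by simp
    show "v + w \<in> ?K" if "v \<in> ?K" "w \<in> ?K"
      using that by (simp add: ring_distribs sum.distrib)
    have "(\<Sum>q\<in>Q. u q * (c * v q)) = c * (\<Sum>q\<in>Q. u q * v q)"
      by (simp add: sum_distrib_left mult_ac)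
    then show "(\<lambda>x. c * v x) \<in> ?K" if "v \<in> ?K"
      using that by simp
  qed
  then have "fun_space.span X \<subseteq> ?K"
    using u by (intro fun_space.span_minimal) auto
  then have "(\<Sum>q'\<in>Q. u q' * unit_fun q q') = 0" using eq by blast
  moreover have "(\<Sum>q'\<in>Q. u q' * unit_fun q q') = u q"
    using sum.delta[OF Q, of q u] q by (simp add: unit_fun_def if_distrib cong: if_cong)
  ultimately show ?thesis by simp
qed

definition slots :: "('v, 'p) network \<Rightarrow> 'v \<Rightarrow> 'v \<Rightarrow> ('p + nat) set" where
  "slots H S T = Inl ` (other_outputs H T - outp H S) \<union> Inr ` {..<card (outp H S)}"

text \<open>\<open>Inl x\<close> belongs to a relay port \<open>x\<close>, \<open>Inr k\<close> with \<open>k < r\<close> to a zero received at \<open>T\<close>, and the remaining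
  \<open>Inr k\<close> to ports of \<open>S\<close> that stay unused.\<close>

definition slot_vectors ::
  "('v, 'p) network \<Rightarrow> 'v \<Rightarrow> 'v \<Rightarrow> nat \<Rightarrow> 'p + nat \<Rightarrow> ('p \<Rightarrow> 'k::field) set" where
  "slot_vectors H S T r j = (case j of
     Inl x \<Rightarrow> insert (unit_fun x) ((\<lambda>i. unit_fun x - input_column H T i) ` co_inputs H x)
   | Inr k \<Rightarrow> if k < r then input_column H T ` inp H T else unit_fun ` outp H S)"

section \<open>Rado's condition for the slots\<close>

lemma card_slots:
  assumes "wf_network H" and "S \<in> nodes H" and "S \<noteq> T"
  shows "card (slots H S T) = card (other_outputs H T)"
proof -
  have fin: "finite (other_outputs H T)" using finite_other_outputs[OF assms(1)] .
  have sub: "outp H S \<subseteq> other_outputs H T" using assms unfolding other_outputs_def by blast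
  have "card (slots H S T) = card (other_outputs H T - outp H S) + card (outp H S)"
    unfolding slots_def using fin
    by (subst card_Un_disjoint) (auto simp: card_image)
  also have "\<dots> = card (other_outputs H T)"
    using card_Diff_subset[OF finite_subset[OF sub fin] sub] card_mono[OF fin sub] by simp
  finally show ?thesis .
qed

lemma slot_vectors_condition:
  assumes wf: "wf_network H" and S: "S \<in> nodes H" and T: "T \<in> nodes H" and ST: "S \<noteq> T"
    and cut: "\<And>\<Omega>. \<Omega> \<subseteq> nodes H \<Longrightarrow> S \<in> \<Omega> \<Longrightarrow> T \<notin> \<Omega> \<Longrightarrow> r \<le> mat_rank (cut_matrix H \<Omega> :: 'k::field mat)"
    and K: "K \<subseteq> slots H S T"
  shows "card K \<le> fun_space.dim (\<Union>j\<in>K. slot_vectors H S T r j :: ('p \<Rightarrow> 'k) set)"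
proof -
  let ?O = "other_outputs H T" and ?m = "card (outp H S)"
  let ?D = "\<Union>j\<in>K. slot_vectors H S T r j :: ('p \<Rightarrow> 'k) set"
  let ?e = "unit_fun :: 'p \<Rightarrow> 'p \<Rightarrow> 'k" and ?N = "input_column H T :: 'p \<Rightarrow> 'p \<Rightarrow> 'k"
  define Q where "Q = {x. Inl x \<in> K}"
  define L where "L = {k. Inr k \<in> K}"
  have Q: "Q \<subseteq> ?O - outp H S" and L: "L \<subseteq> {..<?m}" and KQL: "K = Inl ` Q \<union> Inr ` L"
    using K unfolding Q_def L_def slots_def by blast+
  have finO: "finite ?O" using finite_other_outputs[OF wf] .
  have finQ: "finite Q" and finL: "finite L"
    using Q L finO finite_subset by blast+
  have cardK: "card K = card Q + card L"
    unfolding KQL using finQ finL by (subst card_Un_disjoint) (auto simp: card_image)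
  have finD: "finite ?D"
  proof (rule finite_UN_I)
    show "finite K" unfolding KQL using finQ finL by blast
    fix j show "finite (slot_vectors H S T r j :: ('p \<Rightarrow> 'k) set)"
      using finite_co_inputs[OF wf] wf_networkD(2)[OF wf T] wf_networkD(3)[OF wf S]
      by (auto simp: slot_vectors_def split: sum.split)
  qed
  have spanD: "v \<in> fun_space.span ?D" if "v \<in> slot_vectors H S T r j" "j \<in> K" for v j
    by (rule fun_space.span_base, rule UN_I, rule that(2), rule that(1))
  have eD: "?e x \<in> ?D" if "x \<in> Q" for x
  proof (rule UN_I[of "Inl x"])
    show "Inl x \<in> K" using that unfolding Q_def by simp
  qed (simp add: slot_vectors_def)
  show ?thesis
  proof (cases "L = {} \<or> (\<exists>k\<in>L. r \<le> k)")
    case True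
    define Q' where "Q' = (if L = {} then Q else Q \<union> outp H S)"
    have finQ': "finite Q'" unfolding Q'_def using finQ wf_networkD(3)[OF wf S] by simp
    have "?e x \<in> ?D" if x: "x \<in> Q'" for x
    proof (cases "x \<in> Q")
      case False
      then obtain k where k: "k \<in> L" "r \<le> k" and xS: "x \<in> outp H S"
        using x True unfolding Q'_def by (auto split: if_splits)
      then have "?e x \<in> slot_vectors H S T r (Inr k)" by (simp add: slot_vectors_def)
      moreover have "Inr k \<in> K" using k unfolding L_def by simp
      ultimately show ?thesis by blast
    qed (rule eD)
    then have "?e ` Q' \<subseteq> fun_space.span ?D"
      using fun_space.span_base by blast
    then have "card (?e ` Q') \<le> fun_space.dim ?D"
      using fun_space.card_independent_le_dim[OF finD] independent_unit_fun[OF finQ'] by blast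
    moreover have "card (?e ` Q') = card Q'"
      by (rule card_image[OF inj_on_subset[OF inj_unit_fun]]) simp
    moreover have "card Q + card L \<le> card Q'"
    proof (cases "L = {}")
      case False
      have "card L \<le> ?m" using card_mono[OF _ L] by simp
      moreover have "card (Q \<union> outp H S) = card Q + ?m"
        using Q finQ wf_networkD(3)[OF wf S] by (intro card_Un_disjoint) auto
      ultimately show ?thesis using False by (simp add: Q'_def)
    qed (simp add: Q'_def)
    ultimately show ?thesis using cardK by linarith
  next
    case False
    then obtain k0 where k0: "k0 \<in> L" and Lr: "\<And>k. k \<in> L \<Longrightarrow> k < r" by (auto simp: not_le)
    have "card L \<le> r"
      using card_mono[of "{..<r}" L] Lr by auto
    \<comment> \<open>A node owning a port of \<open>Q\<close> goes to the side of T, since the span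
      contains N_i for each of its inputs. S is never such a node, as \<open>Q\<close> avoids its
      outputs.\<close>
    define \<Omega> where "\<Omega> = {V \<in> nodes H. V \<noteq> T \<and> outp H V \<inter> Q = {}}"
    have \<Omega>: "\<Omega> \<subseteq> nodes H" "S \<in> \<Omega>" "T \<notin> \<Omega>"
      using S ST Q unfolding \<Omega>_def by auto
    obtain C where C: "independent_columns (cut_matrix H \<Omega> :: 'k mat) C" "card C = r"
      using cut[OF \<Omega>] mat_rank_ge_iff by blast
    have CA: "C \<subseteq> {..<length (cut_cols H \<Omega>)}" and finC: "finite C"
      and ind: "\<And>c j. \<forall>i<length (cut_rows H \<Omega>). (\<Sum>j\<in>C. c j * cut_matrix H \<Omega> $$ (i, j)) = (0::'k) \<Longrightarrow> j \<in> C \<Longrightarrow> c j = 0"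
      using C(1) finite_subset unfolding independent_columns_def by auto
    let ?col = "\<lambda>j. cut_cols H \<Omega> ! j"
    have entry: "?N (?col j) x = cut_matrix H \<Omega> $$ (i, j)"
      if i: "i < length (cut_rows H \<Omega>)" and x: "x = cut_rows H \<Omega> ! i" and j: "j \<in> C" for i j x
    proof -
      have "x \<in> set (cut_rows H \<Omega>)" using i x by simp
      then have "x \<in> ?O"
        using \<Omega> unfolding set_cut_rows[OF wf \<Omega>(1)] other_outputs_def by blast
      then show ?thesis
        using i x j CA by (auto simp: input_column_def cut_matrix_index)
    qed
    have not_Q: "x \<notin> Q" if "x \<in> set (cut_rows H \<Omega>)" for x
    proof -
      have "x \<in> (\<Union>V\<in>\<Omega>. outp H V)" using that set_cut_rows[OF wf \<Omega>(1)] by blast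
      then show ?thesis unfolding \<Omega>_def by blast
    qed
    let ?g = "case_sum ?e (\<lambda>j. ?N (?col j))"
    have split: "(\<Sum>j\<in>Q <+> C. c j * ?g j x) =
        (\<Sum>q\<in>Q. c (Inl q) * ?e q x) + (\<Sum>j\<in>C. c (Inr j) * ?N (?col j) x)" for c x
      using finQ finC by (simp add: sum.Plus)
    \<comment> \<open>The units of \<open>Q\<close> vanish on the rows of the cut, so these rows see
      the columns alone and force their coefficients to zero. Evaluation at ports of
      \<open>Q\<close> then settles the units.\<close>
    have indg: "c j = 0" if c: "\<And>x. (\<Sum>j\<in>Q <+> C. c j * ?g j x) = 0" and j: "j \<in> Q <+> C" for c j
    proof -
      have cR: "c (Inr j) = 0" if "j \<in> C" for j
      proof (rule ind[of "\<lambda>j. c (Inr j)", OF _ that], intro allI impI)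
        fix i assume i: "i < length (cut_rows H \<Omega>)"
        let ?x = "cut_rows H \<Omega> ! i"
        have "(\<Sum>q\<in>Q. c (Inl q) * ?e q ?x) = 0"
          using not_Q[of ?x] i by (simp add: sum_unit_fun[OF finQ])
        then have "(\<Sum>j\<in>C. c (Inr j) * ?N (?col j) ?x) = 0"
          using c[of ?x] split[of c ?x] by simp
        moreover have "(\<Sum>j\<in>C. c (Inr j) * ?N (?col j) ?x) = (\<Sum>j\<in>C. c (Inr j) * cut_matrix H \<Omega> $$ (i, j))"
          using entry[OF i refl] by (intro sum.cong) auto
        ultimately show "(\<Sum>j\<in>C. c (Inr j) * cut_matrix H \<Omega> $$ (i, j)) = 0" by simp
      qed
      have cL: "c (Inl q) = 0" if "q \<in> Q" for q
      proof -
        have "(\<Sum>j\<in>C. c (Inr j) * ?N (?col j) q) = 0" using cR by (intro sum.neutral) auto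
        then show ?thesis using c[of q] split[of c q] that by (simp add: sum_unit_fun[OF finQ])
      qed
      show ?thesis using j cL cR by (elim PlusE) auto
    qed
    have finP: "finite (Q <+> C)" using finQ finC by simp
    have ind_fam: "inj_on ?g (Q <+> C)" "fun_space.independent (?g ` (Q <+> C))"
      by (rule fun_space_independent_family[OF finP]; rule indg; assumption)+
    \<comment> \<open>Inputs of T are covered by the slot \<open>k0\<close>. Any other node outside
      \<Omega> owns a port x in \<open>Q\<close>, and N_i = e_x - (e_x - N_i).\<close>
    have "?N i \<in> fun_space.span ?D" if i: "i \<in> set (cut_cols H \<Omega>)" for i
    proof -
      obtain V where V: "V \<in> nodes H" "i \<in> inp H V" "V = T \<or> outp H V \<inter> Q \<noteq> {}"
        using i unfolding set_cut_cols[OF wf] \<Omega>_def by blast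
      show ?thesis
      proof (cases "V = T")
        case True
        then have "?N i \<in> slot_vectors H S T r (Inr k0)"
          using V(2) Lr[OF k0] by (simp add: slot_vectors_def)
        moreover have "Inr k0 \<in> K" using k0 unfolding L_def by simp
        ultimately show ?thesis by (rule spanD)
      next
        case False
        then obtain x where x: "x \<in> outp H V" "x \<in> Q" using V(3) by blast
        have "?e x - ?N i \<in> slot_vectors H S T r (Inl x)"
          using V(2) co_inputs_eq[OF wf V(1) x(1)] by (simp add: slot_vectors_def)
        moreover have "Inl x \<in> K" using x(2) unfolding Q_def by simp
        ultimately have "?e x - ?N i \<in> fun_space.span ?D" by (rule spanD)
        with fun_space.span_base[OF eD[OF x(2)]]
        have "?e x - (?e x - ?N i) \<in> fun_space.span ?D" by (rule fun_space.span_diff)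
        then show ?thesis by simp
      qed
    qed
    note N_span = this
    have "?g j \<in> fun_space.span ?D" if "j \<in> Q <+> C" for j
      using that
    proof (elim PlusE)
      fix q assume "j = Inl q" "q \<in> Q"
      then show ?thesis using fun_space.span_base[OF eD] by simp
    next
      fix l assume l: "j = Inr l" "l \<in> C"
      then have "?col l \<in> set (cut_cols H \<Omega>)" using CA by auto
      then show ?thesis using N_span l(1) by simp
    qed
    then have "?g ` (Q <+> C) \<subseteq> fun_space.span ?D" by (rule image_subsetI)
    then have "card (?g ` (Q <+> C)) \<le> fun_space.dim ?D"
      using fun_space.card_independent_le_dim[OF finD] ind_fam(2) by blast
    moreover have "card (?g ` (Q <+> C)) = card Q + r"
      using card_image[OF ind_fam(1)] card_Plus[OF finQ finC] C(2) by simp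
    ultimately show ?thesis using cardK \<open>card L \<le> r\<close> by linarith
  qed
qed

text \<open>The transversal is read as a code. A vector in the left kernel of its system matrix is
  taken as the values of the source processes; orthogonality to the transversal silences every
  output outside T, including those that carry these values.\<close>

lemma rank_achieving_code:
  fixes H :: "('v, 'p) network"
  assumes wf: "wf_network H" and ac: "acyclic_network H"
    and S: "S \<in> nodes H" and T: "T \<in> nodes H" and ST: "S \<noteq> T"
    and r: "r \<le> card (outp H S)"
    and cut: "\<And>\<Omega>. \<Omega> \<subseteq> nodes H \<Longrightarrow> S \<in> \<Omega> \<Longrightarrow> T \<notin> \<Omega> \<Longrightarrow> r \<le> mat_rank (cut_matrix H \<Omega> :: 'k::field mat)"
  shows "\<exists>\<alpha> \<beta> \<epsilon>. mat_rank (system_matrix H S T r r \<alpha> \<beta> \<epsilon> :: 'k mat) = r"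
proof -
  let ?O = "other_outputs H T" and ?m = "card (outp H S)" and ?J = "slots H S T"
  let ?e = "unit_fun :: 'p \<Rightarrow> 'p \<Rightarrow> 'k" and ?N = "input_column H T :: 'p \<Rightarrow> 'p \<Rightarrow> 'k"
  have finO: "finite ?O" and finS: "finite (outp H S)"
    using finite_other_outputs[OF wf] wf_networkD(3)[OF wf S] by auto
  have SO: "outp H S \<subseteq> ?O" using S ST unfolding other_outputs_def by blast
  have finJ: "finite ?J" using finO unfolding slots_def by simp
  have "\<exists>x. (\<forall>j\<in>?J. x j \<in> slot_vectors H S T r j) \<and> inj_on x ?J \<and>
      fun_space.independent (x ` ?J :: ('p \<Rightarrow> 'k) set)"
  proof (rule fun_space.rado_transversal[OF finJ])
    fix j show "finite (slot_vectors H S T r j :: ('p \<Rightarrow> 'k) set)"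
      using finite_co_inputs[OF wf] wf_networkD(2)[OF wf T] finS
      by (auto simp: slot_vectors_def split: sum.split)
  qed (rule slot_vectors_condition[OF wf S T ST cut])
  then obtain x :: "'p + nat \<Rightarrow> 'p \<Rightarrow> 'k" where x: "\<And>j. j \<in> ?J \<Longrightarrow> x j \<in> slot_vectors H S T r j"
    and inj_x: "inj_on x ?J" and ind_x: "fun_space.independent (x ` ?J)"
    by blast

  \<comment> \<open>A member of a relay set is the zero coefficient vector or a single 1; both are
    brought to the form of a linear relay.\<close>
  have relay: "\<exists>b. x (Inl q) = (\<lambda>z. ?e q z - (\<Sum>i\<in>co_inputs H q. b i * ?N i z))"
    if q: "q \<in> ?O - outp H S" for q
  proof -
    have "x (Inl q) = ?e q \<or> (\<exists>i\<in>co_inputs H q. x (Inl q) = ?e q - ?N i)"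
      using x[of "Inl q"] q by (auto simp: slot_vectors_def slots_def)
    then show ?thesis
    proof (elim disjE bexE)
      assume "x (Inl q) = ?e q"
      then show ?thesis by (intro exI[of _ "\<lambda>_. 0"]) simp
    next
      fix i assume i: "i \<in> co_inputs H q" "x (Inl q) = ?e q - ?N i"
      have "(\<Sum>i'\<in>co_inputs H q. (if i' = i then 1 else 0) * ?N i' z) = ?N i z" for z
      proof -
        have "(\<Sum>i'\<in>co_inputs H q. (if i' = i then 1 else 0) * ?N i' z) =
            (\<Sum>i'\<in>co_inputs H q. if i' = i then ?N i' z else 0)"
          by (intro sum.cong) auto
        then show ?thesis using i(1) finite_co_inputs[OF wf] by simp
      qed
      then show ?thesis
        using i(2) by (intro exI[of _ "\<lambda>i'. if i' = i then 1 else 0"]) (simp add: fun_eq_iff)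
    qed
  qed
  define b where "b q = (SOME b. x (Inl q) = (\<lambda>z. ?e q z - (\<Sum>i\<in>co_inputs H q. b i * ?N i z)))" for q
  have b: "x (Inl q) = (\<lambda>z. ?e q z - (\<Sum>i\<in>co_inputs H q. b q i * ?N i z))"
    if "q \<in> ?O - outp H S" for q
    unfolding b_def by (rule someI_ex[OF relay[OF that]])
  have "\<forall>k. \<exists>i. k < r \<longrightarrow> i \<in> inp H T \<and> x (Inr k) = ?N i"
  proof (rule allI, cases)
    fix k assume "k < r"
    then show "\<exists>i. k < r \<longrightarrow> i \<in> inp H T \<and> x (Inr k) = ?N i"
      using x[of "Inr k"] r by (auto simp: slot_vectors_def slots_def)
  qed auto
  then obtain t where t: "\<And>k. k < r \<Longrightarrow> t k \<in> inp H T \<and> x (Inr k) = ?N (t k)"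
    by metis
  have "\<forall>k. \<exists>s. r \<le> k \<and> k < ?m \<longrightarrow> s \<in> outp H S \<and> x (Inr k) = ?e s"
  proof (rule allI, cases)
    fix k assume "r \<le> k \<and> k < ?m"
    then show "\<exists>s. r \<le> k \<and> k < ?m \<longrightarrow> s \<in> outp H S \<and> x (Inr k) = ?e s"
      using x[of "Inr k"] by (auto simp: slot_vectors_def slots_def)
  qed auto
  then obtain s where s: "\<And>k. r \<le> k \<Longrightarrow> k < ?m \<Longrightarrow> s k \<in> outp H S \<and> x (Inr k) = ?e (s k)"
    by metis
  have "inj_on s {r..<?m}"
  proof (rule inj_onI)
    fix k l assume kl: "k \<in> {r..<?m}" "l \<in> {r..<?m}" "s k = s l"
    then have "x (Inr k) = x (Inr l)" using s[of k] s[of l] by simp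
    moreover have "(Inr k :: 'p + nat) \<in> ?J" "(Inr l :: 'p + nat) \<in> ?J"
      using kl by (auto simp: slots_def)
    ultimately show "k = l" using inj_onD[OF inj_x] by blast
  qed
  then have "card (s ` {r..<?m}) = ?m - r" by (simp add: card_image)
  moreover have "s ` {r..<?m} \<subseteq> outp H S" using s by auto
  ultimately have "card (outp H S - s ` {r..<?m}) = r"
    using card_Diff_subset[of "s ` {r..<?m}" "outp H S"] r by simp
  then obtain y where y: "bij_betw y {..<r} (outp H S - s ` {r..<?m})"
    using ex_bij_betw_nat_finite[of "outp H S - s ` {r..<?m}"] finS
    by (metis atLeast0LessThan finite_Diff)

  \<comment> \<open>Process \<open>l\<close> enters at port \<open>y l\<close> only, destination
    process \<open>k\<close> reads input \<open>t k\<close> only, and nothing is relayed to outputs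
    of S or T.\<close>
  define \<alpha> :: "nat \<times> 'p \<Rightarrow> 'k" where "\<alpha> = (\<lambda>(l, e). if e = y l then 1 else 0)"
  define \<beta> :: "'p \<times> 'p \<Rightarrow> 'k" where "\<beta> = (\<lambda>(i, q). if q \<in> ?O - outp H S then b q i else 0)"
  define \<epsilon> :: "'p \<times> 'v \<times> nat \<Rightarrow> 'k" where "\<epsilon> = (\<lambda>(e, _, k). if e = t k then 1 else 0)"
  let ?M = "system_matrix H S T r r \<alpha> \<beta> \<epsilon>"
  obtain w where w: "\<forall>l<r. \<forall>e\<in>set (ports H). w l e =
      (if e \<in> outp H S then \<alpha> (l, e) else 0) + (\<Sum>e'\<in>set (ports H). w l e' * F_coeff H \<beta> e' e)"
    and M: "\<forall>l<r. \<forall>k<r. ?M $$ (l, k) =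
      (\<Sum>e\<in>set (ports H). w l e * (if e \<in> inp H T then \<epsilon> (e, T, k) else 0))"
    using system_matrix_rows[OF wf ac, of r S \<alpha> \<beta> r T \<epsilon>] by (elim exE conjE)

  have "mat_rank ?M = r"
  proof (rule mat_rank_eq_if_left_kernel_trivial)
    show "?M \<in> carrier_mat r r" by (intro carrier_matI) simp_all
    fix c l
    assume c: "\<And>k. k < r \<Longrightarrow> (\<Sum>l<r. c l * ?M $$ (l, k)) = 0" and l: "l < r"
    \<comment> \<open>The signal on \<open>e\<close> when each source process \<open>l\<close> sends
      the value \<open>c l\<close>.\<close>
    define u where "u e = (\<Sum>l<r. c l * w l e)" for e
    have u: "u e = (\<Sum>l<r. c l * (if e \<in> outp H S then \<alpha> (l, e) else 0)) +
        (\<Sum>e'\<in>set (ports H). u e' * F_coeff H \<beta> e' e)" if e: "e \<in> set (ports H)" for e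
    proof -
      have "c l * w l e = c l * (if e \<in> outp H S then \<alpha> (l, e) else 0) +
          (\<Sum>e'\<in>set (ports H). c l * w l e' * F_coeff H \<beta> e' e)" if "l < r" for l
        unfolding w[rule_format, OF that e] by (simp add: distrib_left sum_distrib_left mult_ac)
      then have "u e = (\<Sum>l<r. c l * (if e \<in> outp H S then \<alpha> (l, e) else 0) +
          (\<Sum>e'\<in>set (ports H). c l * w l e' * F_coeff H \<beta> e' e))"
        unfolding u_def by (intro sum.cong) simp_all
      also have "\<dots> = (\<Sum>l<r. c l * (if e \<in> outp H S then \<alpha> (l, e) else 0)) +
          (\<Sum>e'\<in>set (ports H). u e' * F_coeff H \<beta> e' e)"
        unfolding sum.distrib u_def sum_distrib_right by (subst (2) sum.swap) simp
      finally show ?thesis .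
    qed
    have source_zero: "(\<Sum>l<r. c l * (if e \<in> outp H S then \<alpha> (l, e) else 0)) = 0"
      if "e \<notin> y ` {..<r}" for e
      using that by (intro sum.neutral) (auto simp: \<alpha>_def)
    have y_S: "y ` {..<r} = outp H S - s ` {r..<?m}" using y by (simp add: bij_betw_def)
    have forward: "(\<Sum>e'\<in>set (ports H). u e' * F_coeff H \<beta> e' e) =
        (\<Sum>i\<in>inp H V. u i * \<beta> (i, e))" if V: "V \<in> nodes H" "e \<in> outp H V" for V e
    proof -
      have "(\<Sum>e'\<in>set (ports H). u e' * F_coeff H \<beta> e' e) =
          (\<Sum>e'\<in>set (ports H). if e' \<in> inp H V then u e' * \<beta> (e', e) else 0)"
        using F_coeff_to_outp[OF wf V, of \<beta>] by (intro sum.cong) auto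
      also have "\<dots> = (\<Sum>e'\<in>{e' \<in> set (ports H). e' \<in> inp H V}. u e' * \<beta> (e', e))"
        by (simp add: sum.inter_filter)
      also have "{e' \<in> set (ports H). e' \<in> inp H V} = inp H V"
        using wf_networkD(10)[OF wf V(1)] by blast
      finally show ?thesis .
    qed
    \<comment> \<open>With T silent, the sum for a received signal can be confined to
      \<open>?O\<close>.\<close>
    have u_T: "u e = 0" if e: "e \<in> outp H T" for e
    proof -
      have eO: "e \<notin> ?O" using e wf_networkD(6)[OF wf] T unfolding other_outputs_def by blast
      then have "e \<notin> y ` {..<r}" using y_S SO by blast
      moreover have "(\<Sum>i\<in>inp H T. u i * \<beta> (i, e)) = 0"
        using eO by (simp add: \<beta>_def)
      ultimately show ?thesis
        using u[OF wf_networkD(11)[OF wf T e]] source_zero forward[OF T e] by simp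
    qed
    have u_in: "u i = (\<Sum>q\<in>?O. u q * ?N i q)" if V: "V \<in> nodes H" "i \<in> inp H V" for V i
    proof -
      have "i \<notin> y ` {..<r}" using wf_networkD(4)[OF wf V(1) S V(2)] y_S by blast
      then have "u i = (\<Sum>e'\<in>set (ports H). u e' * F_coeff H \<beta> e' i)"
        using u[OF wf_networkD(10)[OF wf V]] source_zero by simp
      also have "\<dots> = (\<Sum>q\<in>?O. u q * ?N i q)"
      proof (rule sum.mono_neutral_cong_right)
        show "?O \<subseteq> set (ports H)" using wf_networkD(11)[OF wf] unfolding other_outputs_def by blast
        show "\<forall>e'\<in>set (ports H) - ?O. u e' * F_coeff H \<beta> e' i = 0"
        proof
          fix e' assume e': "e' \<in> set (ports H) - ?O"
          show "u e' * F_coeff H \<beta> e' i = 0"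
          proof (cases "(e', i) \<in> edges H")
            case True
            then obtain W where "W \<in> nodes H" "e' \<in> outp H W" using wf_networkD(7)[OF wf] by blast
            then have "e' \<in> outp H T" using e' unfolding other_outputs_def by blast
            then show ?thesis using u_T by simp
          qed (simp add: F_coeff_to_inp[OF wf V])
        qed
        show "u q * F_coeff H \<beta> q i = u q * ?N i q" if "q \<in> ?O" for q
          using that by (simp add: F_coeff_to_inp[OF wf V] input_column_def)
      qed simp
      finally show ?thesis .
    qed
    have unit: "(\<Sum>q\<in>?O. u q * ?e q' q) = u q'" if "q' \<in> ?O" for q'
    proof -
      have "(\<Sum>q\<in>?O. u q * ?e q' q) = (\<Sum>q\<in>?O. if q = q' then u q else 0)"
        by (intro sum.cong) (auto simp: unit_fun_def)
      then show ?thesis using that finO by simp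
    qed
    have orth: "(\<Sum>q\<in>?O. u q * x j q) = 0" if j: "j \<in> ?J" for j
    proof -
      consider (relay) q where "j = Inl q" "q \<in> ?O - outp H S"
        | (sink) k where "j = Inr k" "k < r"
        | (source) k where "j = Inr k" "r \<le> k" "k < ?m"
        using j unfolding slots_def by (auto simp: not_less) (metis not_less)
      then show ?thesis
      proof cases
        case (relay q)
        obtain V where V: "V \<in> nodes H" "q \<in> outp H V"
          using relay(2) unfolding other_outputs_def by blast
        have co: "co_inputs H q = inp H V" by (rule co_inputs_eq[OF wf V])
        have "(\<Sum>q'\<in>?O. u q' * x j q') =
            (\<Sum>q'\<in>?O. u q' * ?e q q') - (\<Sum>q'\<in>?O. \<Sum>i\<in>inp H V. u q' * (b q i * ?N i q'))"
          unfolding relay(1) b[OF relay(2)] co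
          by (simp add: right_diff_distrib sum_subtractf sum_distrib_left)
        also have "(\<Sum>q'\<in>?O. \<Sum>i\<in>inp H V. u q' * (b q i * ?N i q')) = (\<Sum>i\<in>inp H V. u i * b q i)"
        proof (subst sum.swap, rule sum.cong[OF refl])
          fix i assume i: "i \<in> inp H V"
          show "(\<Sum>q'\<in>?O. u q' * (b q i * ?N i q')) = u i * b q i"
            unfolding u_in[OF V(1) i] sum_distrib_right by (simp add: mult_ac)
        qed
        also have "(\<Sum>q'\<in>?O. u q' * ?e q q') = u q" using unit relay(2) by blast
        also have "u q = (\<Sum>i\<in>inp H V. u i * b q i)"
        proof -
          have "q \<notin> y ` {..<r}" using relay(2) y_S by blast
          then have "u q = (\<Sum>i\<in>inp H V. u i * \<beta> (i, q))"
            using u[OF wf_networkD(11)[OF wf V]] source_zero forward[OF V] by simp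
          then show ?thesis using relay(2) by (simp add: \<beta>_def)
        qed
        finally show ?thesis by simp
      next
        case (sink k)
        have tk: "t k \<in> inp H T" "x j = ?N (t k)" using t[OF sink(2)] sink(1) by auto
        have M_k: "?M $$ (l, k) = w l (t k)" if "l < r" for l
        proof -
          have "?M $$ (l, k) = (\<Sum>e\<in>set (ports H). if e = t k then w l e else 0)"
            unfolding M[rule_format, OF that sink(2)] using tk(1)
            by (intro sum.cong) (auto simp: \<epsilon>_def)
          then show ?thesis using wf_networkD(10)[OF wf T tk(1)] by simp
        qed
        have "u (t k) = (\<Sum>l<r. c l * ?M $$ (l, k))"
          unfolding u_def using M_k by (intro sum.cong) simp_all
        then show ?thesis using c[OF sink(2)] u_in[OF T tk(1)] tk(2) by simp
      next
        case (source k)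
        have sk: "s k \<in> outp H S" "x j = ?e (s k)" using s[OF source(2,3)] source(1) by auto
        have "s k \<notin> y ` {..<r}" using source y_S by auto
        moreover have "(\<Sum>i\<in>inp H S. u i * \<beta> (i, s k)) = 0" using sk(1) by (simp add: \<beta>_def)
        ultimately have "u (s k) = 0"
          using u[OF wf_networkD(11)[OF wf S sk(1)]] source_zero forward[OF S sk(1)] by simp
        then show ?thesis using unit[of "s k"] sk SO by auto
      qed
    qed
    have supp: "x j z = 0" if j: "j \<in> ?J" and z: "z \<notin> ?O" for j z
    proof -
      have N0: "?N i z = 0" for i using z by (simp add: input_column_def)
      have e0: "?e q z = 0" if "q \<in> ?O" for q using z that by (auto simp: unit_fun_def)
      show ?thesis
        using x[OF j] j N0 e0 e0[OF subsetD[OF SO]]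
        by (auto simp: slot_vectors_def slots_def split: if_splits)
    qed
    have "y l \<in> outp H S" using y_S l by blast
    then have "u (y l) = 0"
      using functional_eq_zero[OF finO ind_x _ _ _ _, of u "y l"] finJ supp orth SO
        card_image[OF inj_x] card_slots[OF wf S ST] by auto
    \<comment> \<open>Nothing is relayed to outputs of S and \<open>y\<close> is injective, so port
      \<open>y l\<close> carries process \<open>l\<close> alone.\<close>
    moreover have "u (y l) = c l"
    proof -
      have "(\<Sum>i\<in>inp H S. u i * \<beta> (i, y l)) = 0" using \<open>y l \<in> outp H S\<close> by (simp add: \<beta>_def)
      then have "u (y l) = (\<Sum>l'<r. c l' * \<alpha> (l', y l))"
        using u[OF wf_networkD(11)[OF wf S \<open>y l \<in> outp H S\<close>]] forward[OF S \<open>y l \<in> outp H S\<close>]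
          \<open>y l \<in> outp H S\<close> by simp
      also have "\<dots> = (\<Sum>l'<r. if l' = l then c l' else 0)"
        using y l unfolding bij_betw_def \<alpha>_def by (intro sum.cong) (auto dest: inj_onD)
      also have "\<dots> = c l" using l by simp
      finally show ?thesis .
    qed
    ultimately show "c l = 0" by simp
  qed
  then show ?thesis by blast
qed

section \<open>The minimum cut as a maximum of ranks\<close>

lemma mincut_eq_max_rank:
  fixes H :: "('v, 'p) network"
  assumes wf: "wf_network H" and ac: "acyclic_network H"
    and S: "S \<in> nodes H" and T: "T \<in> nodes H" and ST: "S \<noteq> T"
  shows "mincut TYPE('k::field) H S T =
    Max {mat_rank (system_matrix H S T \<mu> \<nu> \<alpha> \<beta> \<epsilon> :: 'k mat) | \<mu> \<nu> \<alpha> \<beta> \<epsilon>. \<mu> \<le> card (outp H S)}"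
    (is "_ = Max ?R")
proof -
  let ?C = "{mat_rank (cut_matrix H \<Omega> :: 'k mat) | \<Omega>. \<Omega> \<subseteq> nodes H \<and> S \<in> \<Omega> \<and> T \<notin> \<Omega>}"
  let ?r = "mincut TYPE('k) H S T"
  have "?C = (\<lambda>\<Omega>. mat_rank (cut_matrix H \<Omega> :: 'k mat)) ` {\<Omega> \<in> Pow (nodes H). S \<in> \<Omega> \<and> T \<notin> \<Omega>}"
    by auto
  then have finC: "finite ?C" using wf_networkD(1)[OF wf] by simp
  have neC: "?C \<noteq> {}" using S ST by blast
  have le_cut: "?r \<le> mat_rank (cut_matrix H \<Omega> :: 'k mat)"
    if "\<Omega> \<subseteq> nodes H" "S \<in> \<Omega>" "T \<notin> \<Omega>" for \<Omega>
    unfolding mincut_def using that by (intro Min_le[OF finC]) blast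
  have "?r \<in> ?C" unfolding mincut_def by (rule Min_in[OF finC neC])
  then obtain \<Omega> where \<Omega>: "?r = mat_rank (cut_matrix H \<Omega> :: 'k mat)" "\<Omega> \<subseteq> nodes H" "S \<in> \<Omega>" "T \<notin> \<Omega>"
    by blast
  \<comment> \<open>The cut around S alone has one row per output of S, which makes
    \<open>?r\<close> an admissible number of source processes.\<close>
  have "?r \<le> length (cut_rows H {S})"
    using le_cut[of "{S}"] mat_rank_le_dim_row[of "cut_matrix H {S} :: 'k mat"] S ST by simp
  also have "\<dots> = card (outp H S)"
    using distinct_card[of "cut_rows H {S}"] set_cut_rows[OF wf, of "{S}"] S wf_networkD(9)[OF wf]
    by (simp add: cut_rows_def)
  finally have r_le: "?r \<le> card (outp H S)" .
  have upper: "n \<le> ?r" if "n \<in> ?R" for n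
    using that rank_system_matrix_le_cut[OF wf ac \<Omega>(2-4) T] \<Omega>(1) by auto
  \<comment> \<open>\<open>\<nu>\<close> is unbounded, so the finiteness that \<open>Max\<close>
    requires comes from the upper bound.\<close>
  then have "finite ?R" by (meson finite_nat_set_iff_bounded_le)
  moreover have "?r \<in> ?R"
    using rank_achieving_code[OF wf ac S T ST r_le le_cut] r_le by (smt (verit) mem_Collect_eq)
  ultimately show ?thesis using upper by (intro Max_eqI[symmetric]) auto
qed

theorem theorem13:
  fixes G :: "('v, 'p) network"
    and Fs :: "('p \<times> 'p) set set"
    and p :: "('p \<times> 'p) set \<Rightarrow> real"
    and S T :: 'v
  assumes "wf_network G" and "acyclic_network G"
    and "finite Fs" and "\<And>f. f \<in> Fs \<Longrightarrow> f \<subseteq> edges G"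
    and "\<And>f. f \<in> Fs \<Longrightarrow> p f \<ge> 0" and "(\<Sum>f\<in>Fs. p f) = 1"
    and "S \<in> nodes G" and "T \<in> nodes G" and "S \<noteq> T"
  shows "average_mincut TYPE('k::{field,finite}) G Fs p S T =
    (\<Sum>f\<in>Fs. p f * real (Max {mat_rank (system_matrix (delete_edges G f) S T \<mu> \<nu> \<alpha> \<beta> \<epsilon> :: 'k mat)
       | \<mu> \<nu> \<alpha> \<beta> \<epsilon>. \<mu> \<le> card (outp G S)}))"
proof -
  \<comment> \<open>Deleting edges preserves well-formedness, acyclicity, nodes and outputs, so the
    equality holds for each pattern separately; averaging comes afterwards.\<close>
  have "mincut TYPE('k) (delete_edges G f) S T =
      Max {mat_rank (system_matrix (delete_edges G f) S T \<mu> \<nu> \<alpha> \<beta> \<epsilon> :: 'k mat)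
        | \<mu> \<nu> \<alpha> \<beta> \<epsilon>. \<mu> \<le> card (outp G S)}" for f
  proof -
    have "wf_network (delete_edges G f)" "acyclic_network (delete_edges G f)"
      unfolding delete_edges_def
      using wf_network_restrict_edges[OF assms(1)] acyclic_network_restrict_edges[OF assms(2)]
      by blast+
    moreover have "nodes (delete_edges G f) = nodes G" "outp (delete_edges G f) = outp G"
      by (simp_all add: delete_edges_def)
    ultimately show ?thesis
      using mincut_eq_max_rank[of "delete_edges G f" S T, where 'k = 'k] assms(7-9) by simp
  qed
  moreover have "average_mincut TYPE('k) G Fs p S T =
      (\<Sum>f\<in>Fs. p f * real (mincut TYPE('k) (delete_edges G f) S T))"
    unfolding average_mincut_def
    by (subst lebesgue_integral_point_measure_finite) (use assms(3,5) in auto)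
  ultimately show ?thesis by simp
qed

end
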